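(* Let $M = M(S; F(I), G(\Lambda); P)$ be a Rees matrix semigroup (without zero) over a semigroupoid $S$. Suppose $S$ is automatic and $M$ is finitely generated. Then $M$ is automatic.
   Context: Semigroupoids. A (directed) graph $X$ has a set $X^0$ of vertices, a set $X^1$ of edges, and source and target maps $\alpha,\omega: X^1\to X^0$. A semigroupoid $S$ is a small graph (vertices are called objects, edges are called arrows) with a partial multiplication on arrows such that $ef$ is defined if and only if $\omega(e)=\alpha(f)$, in which case $\alpha(ef)=\alpha(e)$ and $\omega(ef)=\omega(f)$, and $e(fg)=(ef)g$ whenever $ef$ and $fg$ are defined. (Thus a semigroupoid is a small category without the requirement of identities.) We write $s\in S$ for $s\in S^1$. $S$ is isolation-free if every object is the source or target of some arrow. A semigroup is regarded as a semigroupoid with one object. Paths and regularity. For a graph $X$, $X^+$ is the free semigroupoid on $X$: its objects are $X^0$, its arrows are the non-empty paths $e_1\cdots e_n$ with $\omega(e_i)=\alpha(e_{i+1})$. All graphs over which regularity is considered are finite. A language $L\subseteq X^+$ is regular if it is regular in the usual sense as a set of words over the alphabet $X^1$ (equivalently, it is accepted by a finite automaton labelled by the graph $X$). Let $X^{\$}$ be $X$ with one extra loop $\$_s$ at each vertex $s$. For $(a,b)\in X^+\times X^+$, let $\delta_X(a,b)\in (X^{\$}\times X^{\$})^+$ be the path obtained by padding the shorter of $a,b$ on the right with copies of $\$_t$, where $t$ is the target of that shorter path, to the length of the longer one, and reading the two paths as a single path of pairs of edges. A relation $R\subseteq X^+\times X^+$ is synchronously regular if $\delta_X(R)$ is a regular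 language (over the edges of $X^{\$}\times X^{\$}$). Automaticity. A choice of representatives for a semigroupoid $S$ is a triple $(X,K,\rho)$ where $X$ is a graph with $X^0=S^0$, $\rho:X^+\to S$ is a surjective semigroupoid morphism that is the identity on objects, and $K\subseteq X^+$ satisfies $\rho(K)=S^1$. It is finitely generated if $X$ has finitely many edges. An automatic structure for $S$ is a finitely generated choice of representatives $(X,K,\rho)$ such that the relation $K_a=\{(u,v)\in K\times K : \omega(u)=\alpha(a),\ \rho(ua)=\rho(v)\}$ is synchronously regular for each edge $a\in X^1$, and the relation $K_a=\{(u,v)\in K\times K: \omega(u)=a,\ \rho(u)=\rho(v)\}$ is synchronously regular for each vertex $a\in X^0$ (regarded as an empty path). $S$ is automatic if it admits an automatic structure. Rees matrix semigroups without zero. Let $S$ be a non-empty isolation-free semigroupoid, $I,\Lambda$ index sets, $F:I\to\alpha(S^1)$ and $G:\Lambda\to\omega(S^1)$ surjective functions, and $P$ a $\Lambda\times I$ matrix with entries in $S^1$ (no zero entries) such that $\alpha(P_{\lambda i})=G(\lambda)$ and $\omega(P_{\lambda i})=F(i)$ for all $\lambda\in\Lambda$, $i\in I$. The Rees matrix semigroup (without zero) $M(S;F(I),G(\Lambda);P)$ (the notation $F(I),G(\Lambda)$ is purely symbolic) has elements $\{(i,x,\lambda)\in I\times S\times\Lambda : F(i)=\alpha(x),\ \omega(x)=G(\lambda)\}$, with multiplication $(i,x,\lambda)(j,y,\mu)=(i,xP_{\lambda j}y,\mu)$. *)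

theory Defs
  imports "Graph_Theory.Arc_Walk"
begin

section \<open>Semigroupoids\<close>

text \<open>
  The multiplication is a total function of the logic; only its values on composable pairs of
  arrows (target of the left factor = source of the right factor) are meaningful.
\<close>

record ('v, 'e) pre_semigroupoid =
  dgraph :: "('v, 'e) pre_digraph"
  mul :: "'e \<Rightarrow> 'e \<Rightarrow> 'e"

abbreviation objects :: "('v, 'e) pre_semigroupoid \<Rightarrow> 'v set" where
  "objects S \<equiv> verts (dgraph S)"

abbreviation arrows :: "('v, 'e) pre_semigroupoid \<Rightarrow> 'e set" where
  "arrows S \<equiv> arcs (dgraph S)"

abbreviation source :: "('v, 'e) pre_semigroupoid \<Rightarrow> 'e \<Rightarrow> 'v" where
  "source S \<equiv> tail (dgraph S)"

abbreviation target :: "('v, 'e) pre_semigroupoid \<Rightarrow> 'e \<Rightarrow> 'v" where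
  "target S \<equiv> head (dgraph S)"

definition composable :: "('v, 'e) pre_semigroupoid \<Rightarrow> 'e \<Rightarrow> 'e \<Rightarrow> bool" where
  "composable S e f \<longleftrightarrow> e \<in> arrows S \<and> f \<in> arrows S \<and> target S e = source S f"

locale semigroupoid =
  fixes S :: "('v, 'e) pre_semigroupoid"
  assumes wf_dgraph: "wf_digraph (dgraph S)"
    and mul_closed: "composable S e f \<Longrightarrow> mul S e f \<in> arrows S"
    and source_mul: "composable S e f \<Longrightarrow> source S (mul S e f) = source S e"
    and target_mul: "composable S e f \<Longrightarrow> target S (mul S e f) = target S f"
    and mul_assoc: "composable S e f \<Longrightarrow> composable S f g \<Longrightarrow>
          mul S e (mul S f g) = mul S (mul S e f) g"

definition isolation_free :: "('v, 'e) pre_semigroupoid \<Rightarrow> bool" where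
  "isolation_free S \<longleftrightarrow> (\<forall>v\<in>objects S. \<exists>e\<in>arrows S. source S e = v \<or> target S e = v)"

definition semigroupoid_hom ::
    "('v, 'e) pre_semigroupoid \<Rightarrow> ('w, 'f) pre_semigroupoid \<Rightarrow> ('v \<Rightarrow> 'w) \<Rightarrow> ('e \<Rightarrow> 'f) \<Rightarrow> bool" where
  "semigroupoid_hom S T f0 f1 \<longleftrightarrow>
     f0 ` objects S \<subseteq> objects T \<and> f1 ` arrows S \<subseteq> arrows T \<and>
     (\<forall>e\<in>arrows S. source T (f1 e) = f0 (source S e) \<and> target T (f1 e) = f0 (target S e)) \<and>
     (\<forall>e f. composable S e f \<longrightarrow> f1 (mul S e f) = mul T (f1 e) (f1 f))"

inductive_set generated :: "('v, 'e) pre_semigroupoid \<Rightarrow> 'e set \<Rightarrow> 'e set"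
  for S :: "('v, 'e) pre_semigroupoid" and A :: "'e set" where
  base: "a \<in> A \<Longrightarrow> a \<in> generated S A"
| mul: "e \<in> generated S A \<Longrightarrow> f \<in> generated S A \<Longrightarrow> target S e = source S f \<Longrightarrow>
        mul S e f \<in> generated S A"

definition finitely_generated :: "('v, 'e) pre_semigroupoid \<Rightarrow> bool" where
  "finitely_generated S \<longleftrightarrow> (\<exists>A. finite A \<and> A \<subseteq> arrows S \<and> generated S A = arrows S)"

definition semigroup_semigroupoid :: "'a set \<Rightarrow> ('a \<Rightarrow> 'a \<Rightarrow> 'a) \<Rightarrow> (unit, 'a) pre_semigroupoid" where
  "semigroup_semigroupoid A m =
     \<lparr>dgraph = \<lparr>verts = {()}, arcs = A, tail = (\<lambda>_. ()), head = (\<lambda>_. ())\<rparr>, mul = m\<rparr>"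

section \<open>Paths and synchronously regular relations\<close>

definition path_source :: "('v, 'e) pre_digraph \<Rightarrow> 'e list \<Rightarrow> 'v" where
  "path_source X p = tail X (hd p)"

definition path_target :: "('v, 'e) pre_digraph \<Rightarrow> 'e list \<Rightarrow> 'v" where
  "path_target X p = head X (last p)"

definition paths :: "('v, 'e) pre_digraph \<Rightarrow> 'e list set" where
  "paths X = {p. p \<noteq> [] \<and> (\<exists>u v. pre_digraph.awalk X u p v)}"

definition free_semigroupoid :: "('v, 'e) pre_digraph \<Rightarrow> ('v, 'e list) pre_semigroupoid" where
  "free_semigroupoid X =
     \<lparr>dgraph = \<lparr>verts = verts X, arcs = paths X, tail = path_source X, head = path_target X\<rparr>,
      mul = (@)\<rparr>"

text \<open>
  Deterministic automata; since state sets are finite, taking states in \<^typ>\<open>nat\<close> is no loss of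
  generality.
\<close>

definition regular_language :: "'a set \<Rightarrow> 'a list set \<Rightarrow> bool" where
  "regular_language A L \<longleftrightarrow> finite A \<and>
     (\<exists>(Q :: nat set) q0 \<delta> T. finite Q \<and> q0 \<in> Q \<and> T \<subseteq> Q \<and> (\<forall>q\<in>Q. \<forall>a\<in>A. \<delta> q a \<in> Q) \<and>
        L = {w \<in> lists A. foldl \<delta> q0 w \<in> T})"

text \<open>The padding loop at a vertex \<open>s\<close> is \<^term>\<open>Inr s\<close>.\<close>

definition pad_graph :: "('v, 'e) pre_digraph \<Rightarrow> ('v, 'e + 'v) pre_digraph" where
  "pad_graph X =
     \<lparr>verts = verts X, arcs = Inl ` arcs X \<union> Inr ` verts X,
      tail = case_sum (tail X) id, head = case_sum (head X) id\<rparr>"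

definition graph_prod ::
    "('v, 'e) pre_digraph \<Rightarrow> ('w, 'f) pre_digraph \<Rightarrow> ('v \<times> 'w, 'e \<times> 'f) pre_digraph" where
  "graph_prod X Y =
     \<lparr>verts = verts X \<times> verts Y, arcs = arcs X \<times> arcs Y,
      tail = map_prod (tail X) (tail Y), head = map_prod (head X) (head Y)\<rparr>"

definition pad_to :: "('v, 'e) pre_digraph \<Rightarrow> nat \<Rightarrow> 'e list \<Rightarrow> ('e + 'v) list" where
  "pad_to X n p = map Inl p @ replicate (n - length p) (Inr (path_target X p))"

definition pad_pair ::
    "('v, 'e) pre_digraph \<Rightarrow> 'e list \<times> 'e list \<Rightarrow> (('e + 'v) \<times> ('e + 'v)) list" where
  "pad_pair X = (\<lambda>(a, b). let n = max (length a) (length b) in zip (pad_to X n a) (pad_to X n b))"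

definition synchronously_regular ::
    "('v, 'e) pre_digraph \<Rightarrow> ('e list \<times> 'e list) set \<Rightarrow> bool" where
  "synchronously_regular X R \<longleftrightarrow> R \<subseteq> paths X \<times> paths X \<and>
     regular_language (arcs (graph_prod (pad_graph X) (pad_graph X))) (pad_pair X ` R)"

section \<open>Automaticity\<close>

definition choice_of_representatives ::
    "('v, 'e) pre_semigroupoid \<Rightarrow> ('v, 'x) pre_digraph \<Rightarrow> 'x list set \<Rightarrow> ('x list \<Rightarrow> 'e) \<Rightarrow> bool" where
  "choice_of_representatives S X K \<rho> \<longleftrightarrow>
     wf_digraph X \<and> verts X = objects S \<and>
     semigroupoid_hom (free_semigroupoid X) S id \<rho> \<and> \<rho> ` paths X = arrows S \<and>
     K \<subseteq> paths X \<and> \<rho> ` K = arrows S"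

definition edge_relation ::
    "('v, 'x) pre_digraph \<Rightarrow> 'x list set \<Rightarrow> ('x list \<Rightarrow> 'e) \<Rightarrow> 'x \<Rightarrow> ('x list \<times> 'x list) set" where
  "edge_relation X K \<rho> a =
     {(u, v) \<in> K \<times> K. path_target X u = tail X a \<and> \<rho> (u @ [a]) = \<rho> v}"

definition vertex_relation ::
    "('v, 'x) pre_digraph \<Rightarrow> 'x list set \<Rightarrow> ('x list \<Rightarrow> 'e) \<Rightarrow> 'v \<Rightarrow> ('x list \<times> 'x list) set" where
  "vertex_relation X K \<rho> s = {(u, v) \<in> K \<times> K. path_target X u = s \<and> \<rho> u = \<rho> v}"

text \<open>
  Regularity is only considered over finite graphs, so the vertex set is required to be finite
  along with the edge set; for isolation-free semigroupoids finiteness of the former follows from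
  finiteness of the latter.
\<close>

definition automatic_structure ::
    "('v, 'e) pre_semigroupoid \<Rightarrow> ('v, 'x) pre_digraph \<Rightarrow> 'x list set \<Rightarrow> ('x list \<Rightarrow> 'e) \<Rightarrow> bool" where
  "automatic_structure S X K \<rho> \<longleftrightarrow>
     choice_of_representatives S X K \<rho> \<and> fin_digraph X \<and>
     (\<forall>a\<in>arcs X. synchronously_regular X (edge_relation X K \<rho> a)) \<and>
     (\<forall>s\<in>verts X. synchronously_regular X (vertex_relation X K \<rho> s))"

text \<open>Since edge sets are finite, taking edges in \<^typ>\<open>nat\<close> is no loss of generality.\<close>

definition automatic :: "('v, 'e) pre_semigroupoid \<Rightarrow> bool" where
  "automatic S \<longleftrightarrow> (\<exists>(X :: ('v, nat) pre_digraph) K \<rho>. automatic_structure S X K \<rho>)"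

section \<open>Rees matrix semigroups without zero\<close>

locale rees_matrix_data = semigroupoid S
  for S :: "('v, 'e) pre_semigroupoid" +
  fixes I :: "'i set" and \<Lambda> :: "'l set"
    and F :: "'i \<Rightarrow> 'v" and G :: "'l \<Rightarrow> 'v" and P :: "'l \<Rightarrow> 'i \<Rightarrow> 'e"
  assumes nonempty: "arrows S \<noteq> {}"
    and isolation_free: "isolation_free S"
    and F_surj: "F ` I = source S ` arrows S"
    and G_surj: "G ` \<Lambda> = target S ` arrows S"
    and P_arrow: "l \<in> \<Lambda> \<Longrightarrow> i \<in> I \<Longrightarrow> P l i \<in> arrows S"
    and P_source: "l \<in> \<Lambda> \<Longrightarrow> i \<in> I \<Longrightarrow> source S (P l i) = G l"
    and P_target: "l \<in> \<Lambda> \<Longrightarrow> i \<in> I \<Longrightarrow> target S (P l i) = F i"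

definition rees_carrier ::
    "('v, 'e) pre_semigroupoid \<Rightarrow> 'i set \<Rightarrow> 'l set \<Rightarrow> ('i \<Rightarrow> 'v) \<Rightarrow> ('l \<Rightarrow> 'v) \<Rightarrow> ('i \<times> 'e \<times> 'l) set" where
  "rees_carrier S I \<Lambda> F G =
     {(i, x, l) \<in> I \<times> arrows S \<times> \<Lambda>. F i = source S x \<and> target S x = G l}"

definition rees_mul ::
    "('v, 'e) pre_semigroupoid \<Rightarrow> ('l \<Rightarrow> 'i \<Rightarrow> 'e) \<Rightarrow> 'i \<times> 'e \<times> 'l \<Rightarrow> 'i \<times> 'e \<times> 'l \<Rightarrow> 'i \<times> 'e \<times> 'l" where
  "rees_mul S P = (\<lambda>(i, x, l) (j, y, m). (i, mul S (mul S x (P l j)) y, m))"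

definition rees_matrix_semigroup ::
    "('v, 'e) pre_semigroupoid \<Rightarrow> 'i set \<Rightarrow> 'l set \<Rightarrow> ('i \<Rightarrow> 'v) \<Rightarrow> ('l \<Rightarrow> 'v) \<Rightarrow> ('l \<Rightarrow> 'i \<Rightarrow> 'e) \<Rightarrow>
     (unit, 'i \<times> 'e \<times> 'l) pre_semigroupoid" where
  "rees_matrix_semigroup S I \<Lambda> F G P =
     semigroup_semigroupoid (rees_carrier S I \<Lambda> F G) (rees_mul S P)"

section \<open>Well-formedness of the constructions\<close>

lemma cas_append_path:
  "p \<noteq> [] \<Longrightarrow> q \<noteq> [] \<Longrightarrow> pre_digraph.cas X u (p @ q) w \<longleftrightarrow>
     pre_digraph.cas X u p (head X (last p)) \<and> head X (last p) = tail X (hd q) \<and>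
     pre_digraph.cas X (tail X (hd q)) q w"
proof (induction p arbitrary: u)
  case (Cons e p)
  then show ?case
    by (cases "p = []"; cases q) (auto simp: pre_digraph.cas.simps)
qed simp

lemma cas_target: "p \<noteq> [] \<Longrightarrow> pre_digraph.cas X u p w \<Longrightarrow> w = head X (last p)"
  by (induction p arbitrary: u) (auto simp: pre_digraph.cas.simps split: if_splits)

lemma cas_source: "p \<noteq> [] \<Longrightarrow> pre_digraph.cas X u p w \<Longrightarrow> u = tail X (hd p)"
  by (cases p) (auto simp: pre_digraph.cas.simps)

lemma paths_iff:
  assumes "wf_digraph X"
  shows "p \<in> paths X \<longleftrightarrow> p \<noteq> [] \<and> set p \<subseteq> arcs X \<and>
           pre_digraph.cas X (path_source X p) p (path_target X p)"
proof -
  have "tail X (hd p) \<in> verts X" if "p \<noteq> []" "set p \<subseteq> arcs X"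
    using that assms by (cases p) (auto simp: wf_digraph_def)
  then show ?thesis
    unfolding paths_def pre_digraph.awalk_def path_source_def path_target_def
    by (auto dest: cas_target cas_source)
qed

lemma paths_append_iff:
  assumes "wf_digraph X" "p \<noteq> []" "q \<noteq> []"
  shows "p @ q \<in> paths X \<longleftrightarrow> p \<in> paths X \<and> q \<in> paths X \<and> path_target X p = path_source X q"
  using assms by (auto simp: paths_iff cas_append_path path_source_def path_target_def)

lemma semigroupoid_free_semigroupoid:
  assumes X: "wf_digraph X"
  shows "semigroupoid (free_semigroupoid X)"
proof -
  have ne: "p \<noteq> []" if "p \<in> paths X" for p using that by (simp add: paths_def)
  have "path_source X p \<in> verts X \<and> path_target X p \<in> verts X" if "p \<in> paths X" for p
  proof -
    have "hd p \<in> arcs X" "last p \<in> arcs X" using that by (auto simp: paths_iff[OF X])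
    then show ?thesis
      using X by (auto simp: path_source_def path_target_def wf_digraph_def)
  qed
  then show ?thesis
    by unfold_locales
      (auto simp: free_semigroupoid_def composable_def paths_append_iff[OF X] ne,
       auto simp: path_source_def path_target_def ne)
qed

context rees_matrix_data
begin

lemma semigroupoid_rees: "semigroupoid (rees_matrix_semigroup S I \<Lambda> F G P)"
proof
  fix a b c
  let ?M = "rees_matrix_semigroup S I \<Lambda> F G P"
  note d = rees_matrix_semigroup_def semigroup_semigroupoid_def rees_carrier_def rees_mul_def
  note c = composable_def mul_closed source_mul target_mul P_arrow P_source P_target
  show "composable ?M a b \<Longrightarrow> mul ?M a b \<in> arrows ?M"
    by (auto simp: d c)
  show "composable ?M a b \<Longrightarrow> composable ?M b c \<Longrightarrow>
      mul ?M a (mul ?M b c) = mul ?M (mul ?M a b) c"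
    by (auto simp: d c mul_assoc)
qed (auto simp: rees_matrix_semigroup_def semigroup_semigroupoid_def)

end

end

theory Submission
  imports Defs
begin

text \<open>
  Finite generation of the Rees matrix semigroup makes the index sets finite, and makes all but
  finitely many arrows of \<open>S\<close> products \<open>s P t\<close> around an entry of the matrix; these products form
  an ideal. Keep only the representatives of minimal length. By pigeonhole there is a length
  \<open>N\<close> such that every factor of length \<open>N\<close> of such a word has its value in the ideal. Cut a
  minimal word \<open>w\<close> into blocks of length \<open>N\<close> with values \<open>s\<^sub>k P t\<^sub>k\<close>, the last one at most that
  long and with value \<open>r\<close>. Then \<open>(i, \<rho> w, l)\<close> is the product of the elements with middle components
  \<open>s\<^sub>1, t\<^sub>1 s\<^sub>2, t\<^sub>2 s\<^sub>3, \<dots>, t\<^sub>m r\<close>. All blocks have the same length, so this recoding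
  preserves synchronous regularity, and right multiplication by a letter becomes right
  multiplication in \<open>S\<close> by a fixed arrow, which is a composition of the given edge relations.

  Regularity is handled in the style of Myhill and Nerode, by counting residuals of a relation.
\<close>

subsection \<open>Residuals of relations on words\<close>

text \<open>
  Tape \<open>a\<close> is shorter than \<open>n\<close> only if it has ended. So \<open>residual R a b n\<close> is what a padded
  automaton for \<open>R\<close> has to remember after \<open>n\<close> steps, stated without any padding symbols.
\<close>

definition residual :: "('a list \<times> 'b list) set \<Rightarrow> 'a list \<Rightarrow> 'b list \<Rightarrow> nat \<Rightarrow> ('a list \<times> 'b list) set" where
  "residual R a b n = {(x, y). (a @ x, b @ y) \<in> R \<and> take n (a @ x) = a \<and> take n (b @ y) = b}"

definition residuals :: "('a list \<times> 'b list) set \<Rightarrow> ('a list \<times> 'b list) set set" where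
  "residuals R = {residual R a b n |a b n. True}"

lemma residual_in_residuals [simp]: "residual R a b n \<in> residuals R"
  by (auto simp: residuals_def)

lemma finite_residualsI:
  "finite C \<Longrightarrow> (\<And>a b n. residual R a b n \<in> C) \<Longrightarrow> finite (residuals R)"
  by (rule finite_subset[of _ C]) (auto simp: residuals_def)

text \<open>Finitely many sets have only finitely many unions. This takes the role of the subset
  construction wherever a word is guessed existentially.\<close>

lemma finite_residuals_UnionI:
  assumes "finite C" "\<And>a b n. \<exists>D\<subseteq>C. residual R a b n = \<Union>D"
  shows "finite (residuals R)"
proof (rule finite_residualsI[of "Union ` Pow C"])
  show "finite (Union ` Pow C)" using assms(1) by simp
  show "residual R a b n \<in> Union ` Pow C" for a b n
    using assms(2)[of a b n] by (metis PowI imageI)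
qed

text \<open>The pair of residuals is the state of the product automaton; any operation that commutes
  with taking residuals is covered.\<close>

lemma finite_residuals_combine:
  assumes "finite (residuals R)" "finite (residuals T)"
    and "\<And>a b n. residual Q a b n = f (residual R a b n) (residual T a b n)"
  shows "finite (residuals Q)"
proof (rule finite_residualsI)
  show "finite ((\<lambda>(A, B). f A B) ` (residuals R \<times> residuals T))" using assms(1,2) by simp
  show "residual Q a b n \<in> (\<lambda>(A, B). f A B) ` (residuals R \<times> residuals T)" for a b n
    unfolding assms(3) by (rule image_eqI[of _ _ "(residual R a b n, residual T a b n)"]) auto
qed

lemma finite_residuals_Un:
  "finite (residuals R) \<Longrightarrow> finite (residuals T) \<Longrightarrow> finite (residuals (R \<union> T))"
  by (erule (1) finite_residuals_combine[where f = "(\<union>)"]) (auto simp: residual_def simp del: take_append)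

lemma finite_residuals_Int:
  "finite (residuals R) \<Longrightarrow> finite (residuals T) \<Longrightarrow> finite (residuals (R \<inter> T))"
  by (erule (1) finite_residuals_combine[where f = "(\<inter>)"]) (auto simp: residual_def simp del: take_append)

lemma finite_residuals_Diff:
  "finite (residuals R) \<Longrightarrow> finite (residuals T) \<Longrightarrow> finite (residuals (R - T))"
  by (erule (1) finite_residuals_combine[where f = "(-)"]) (auto simp: residual_def simp del: take_append)

lemma finite_residuals_empty: "finite (residuals {})"
  by (rule finite_residualsI[of "{{}}"]) (auto simp: residual_def)

lemma finite_residuals_UN:
  "finite A \<Longrightarrow> (\<And>i. i \<in> A \<Longrightarrow> finite (residuals (R i))) \<Longrightarrow> finite (residuals (\<Union>i\<in>A. R i))"
  by (induction A rule: finite_induct) (auto intro: finite_residuals_empty finite_residuals_Un)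

lemma residual_drop: "take n (a @ x) = a \<Longrightarrow> drop n (a @ x) = x"
  using append_take_drop_id[of n "a @ x"] by (simp del: take_append append_take_drop_id drop_append)

text \<open>The middle word is cut at the same \<open>n\<close>, and its prefix \<open>b\<close> is
  guessed. The union may run over infinitely many \<open>b\<close>, but it has only finitely many
  different terms when both factors have finitely many residuals.\<close>

lemma residual_relcomp:
  "residual (R O T) a c n = (\<Union>b. residual R a b n O residual T b c n)"
proof (intro set_eqI iffI; clarify)
  fix x z assume "(x, z) \<in> residual (R O T) a c n"
  then obtain v where v: "(a @ x, v) \<in> R" "(v, c @ z) \<in> T" "take n (a @ x) = a" "take n (c @ z) = c"
    by (auto simp: residual_def)
  then have "(x, drop n v) \<in> residual R a (take n v) n" "(drop n v, z) \<in> residual T (take n v) c n"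
    by (auto simp: residual_def simp del: take_append)
  then show "(x, z) \<in> (\<Union>b. residual R a b n O residual T b c n)" by blast
qed (auto simp: residual_def simp del: take_append)

lemma finite_residuals_relcomp:
  assumes "finite (residuals R)" "finite (residuals T)"
  shows "finite (residuals (R O T))"
proof (rule finite_residuals_UnionI)
  let ?C = "(\<lambda>(A, B). A O B) ` (residuals R \<times> residuals T)"
  show "finite ?C" using assms by simp
  show "\<exists>D\<subseteq>?C. residual (R O T) a c n = \<Union>D" for a c n
    by (rule exI[of _ "range (\<lambda>b. residual R a b n O residual T b c n)"])
      (auto simp: residual_relcomp)
qed

text \<open>Projection onto the second tape. The resulting language is kept as a diagonal relation,
  so that it can be composed with and subtracted from other relations. The prefix \<open>c\<close>
  of the forgotten tape is guessed.\<close>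

lemma finite_residuals_Id_on_Range:
  assumes "finite (residuals R)"
  shows "finite (residuals (Id_on (Range R)))"
proof (rule finite_residuals_UnionI)
  let ?C = "(\<lambda>A. Id_on (Range A)) ` residuals R"
  show "finite ?C" using assms by simp
  fix a b n
  show "\<exists>D\<subseteq>?C. residual (Id_on (Range R)) a b n = \<Union>D"
  proof (cases "a = b")
    case True
    have "residual (Id_on (Range R)) b b n = (\<Union>c. Id_on (Range (residual R c b n)))"
    proof (intro set_eqI iffI; clarify)
      fix x y assume "(x, y) \<in> residual (Id_on (Range R)) b b n"
      then obtain u where u: "(u, b @ x) \<in> R" "x = y" "take n (b @ x) = b"
        by (auto simp: residual_def)
      then have "(drop n u, x) \<in> residual R (take n u) b n"
        by (auto simp: residual_def simp del: take_append)
      then show "(x, y) \<in> (\<Union>c. Id_on (Range (residual R c b n)))" using u by blast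
    qed (auto simp: residual_def simp del: take_append)
    then show ?thesis
      using True by (intro exI[of _ "range (\<lambda>c. Id_on (Range (residual R c b n)))"]) auto
  next
    case False
    then have "residual (Id_on (Range R)) a b n = \<Union>{}"
      by (auto simp: residual_def simp del: take_append)
    then show ?thesis by blast
  qed
qed

lemma finite_residuals_shorter: "finite (residuals {(u, v). length u < length v})"
proof (rule finite_residualsI)
  let ?C = "{{}, {(x, y). length x < length y}, {([], y) |y. True}, {([], [])}}"
  show "finite ?C" by simp
  fix a :: "'a list" and b :: "'b list" and n
  \<comment> \<open>A prefix shorter than \<open>n\<close> marks a tape that has ended. In turn:
    both tapes may run on; only the first has ended, so every continuation of the second is allowed;
    both have ended in the right order; no pair is left.\<close>
  consider "length a = n" "length b = n" | "length a < n" "length b = n"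
    | "length a < n" "length b < n" "length a < length b"
    | "length a > n \<or> length b > n \<or> length a \<le> n \<and> length b < n \<and> length b \<le> length a"
    by linarith
  then show "residual {(u, v). length u < length v} a b n \<in> ?C"
  proof cases
    case 1
    then have "residual {(u, v). length u < length v} a b n = {(x, y). length x < length y}"
      by (auto simp: residual_def)
    then show ?thesis by simp
  next
    case 2
    then have "residual {(u, v). length u < length v} a b n = {([], y) |y. True}"
      by (auto simp: residual_def)
    then show ?thesis by simp
  next
    case 3
    then have "residual {(u, v). length u < length v} a b n = {([], [])}"
      by (auto simp: residual_def)
    then show ?thesis by simp
  next
    case 4
    then have "residual {(u, v). length u < length v} a b n = {}"
      by (auto simp: residual_def dest: arg_cong[of _ _ length])
    then show ?thesis by simp
  qed
qed

text \<open>These are the states of the minimal complete deterministic automaton for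
  \<open>L\<close>.\<close>

definition left_quotients :: "'a list set \<Rightarrow> 'a list set set" where
  "left_quotients L = range (\<lambda>w. {x. w @ x \<in> L})"

text \<open>The two tapes are independent. On each one the residual is a left quotient while the
  tape runs, that quotient cut down to the empty word once the tape has ended, and empty if the
  prefix is longer than \<open>n\<close>.\<close>

lemma finite_residuals_Times:
  assumes "finite (left_quotients L)" "finite (left_quotients M)"
  shows "finite (residuals (L \<times> M))"
proof (rule finite_residualsI)
  let ?l = "left_quotients L \<union> (\<lambda>A. A \<inter> {[]}) ` left_quotients L \<union> {{}}"
  let ?m = "left_quotients M \<union> (\<lambda>A. A \<inter> {[]}) ` left_quotients M \<union> {{}}"
  show "finite ((\<lambda>(A, B). A \<times> B) ` (?l \<times> ?m))" using assms by simp
  fix a :: "'a list" and b :: "'b list" and n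
  have *: "{x. w @ x \<in> N \<and> take n (w @ x) = w} \<in> left_quotients N \<union> (\<lambda>A. A \<inter> {[]}) ` left_quotients N \<union> {{}}"
    for w :: "'c list" and N
  proof -
    have "{x. w @ x \<in> N} \<in> left_quotients N" by (auto simp: left_quotients_def)
    moreover have "{x. w @ x \<in> N \<and> take n (w @ x) = w} =
      (if length w < n then {x. w @ x \<in> N} \<inter> {[]} else if length w = n then {x. w @ x \<in> N} else {})"
      by (auto dest: arg_cong[of _ _ length])
    ultimately show ?thesis by auto
  qed
  have "residual (L \<times> M) a b n =
      {x. a @ x \<in> L \<and> take n (a @ x) = a} \<times> {y. b @ y \<in> M \<and> take n (b @ y) = b}"
    by (auto simp: residual_def)
  then show "residual (L \<times> M) a b n \<in> (\<lambda>(A, B). A \<times> B) ` (?l \<times> ?m)"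
    using *[of a L] *[of b M]
    by (intro image_eqI[of _ _ "({x. a @ x \<in> L \<and> take n (a @ x) = a}, {y. b @ y \<in> M \<and> take n (b @ y) = b})"]) blast+
qed

lemma finite_left_quotients_UNIV: "finite (left_quotients UNIV)"
  by (simp add: left_quotients_def)

text \<open>One letter decides membership, so at most three quotients occur.\<close>

lemma finite_left_quotients_hd: "finite (left_quotients {w. w \<noteq> [] \<and> P (hd w)})"
proof (rule finite_subset)
  show "left_quotients {w. w \<noteq> [] \<and> P (hd w)} \<subseteq> {{w. w \<noteq> [] \<and> P (hd w)}, UNIV, {}}"
  proof
    fix D assume "D \<in> left_quotients {w. w \<noteq> [] \<and> P (hd w)}"
    then obtain w where "D = {x. w @ x \<noteq> [] \<and> P (hd (w @ x))}"
      by (auto simp: left_quotients_def)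
    then show "D \<in> {{w. w \<noteq> [] \<and> P (hd w)}, UNIV, {}}"
      by (cases w; cases "P (hd w)") auto
  qed
qed simp

text \<open>
  If a map on words respects cutting after \<open>n\<close> letters, respectively \<open>n * N\<close> letters, then
  the residuals of a preimage are preimages of residuals.
\<close>

lemma finite_residuals_vimage:
  assumes R: "finite (residuals R)" and W: "finite (residuals W)"
    and take: "\<And>u v n. (u, v) \<in> W \<Longrightarrow> take (n * N) (h u) = h (take n u) \<and> take (n * N) (h v) = h (take n v)"
    and app: "\<And>x y. h (x @ y) = h x @ h y"
  shows "finite (residuals {(u, v) \<in> W. (h u, h v) \<in> R})"
proof (rule finite_residualsI)
  let ?f = "\<lambda>(A, B). {(x, y) \<in> A. (h x, h y) \<in> B}"
  show "finite (?f ` (residuals W \<times> residuals R))" using R W by simp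
  fix a b n
  \<comment> \<open>Cutting a word after \<open>n\<close> letters cuts its image after
    \<open>n * N\<close>. The residual of \<open>R\<close> is therefore taken at the scaled length;
    the residual of \<open>W\<close> keeps the words to those for which this is known.\<close>
  have "residual {(u, v) \<in> W. (h u, h v) \<in> R} a b n = ?f (residual W a b n, residual R (h a) (h b) (n * N))"
  proof -
    have "take (n * N) (h (a @ x)) = h a \<and> take (n * N) (h (b @ y)) = h b"
      if "(a @ x, b @ y) \<in> W" "take n (a @ x) = a" "take n (b @ y) = b" for x y
      using take[OF that(1), of n] that(2,3) by simp
    then show ?thesis unfolding residual_def by (auto simp: app simp del: take_append)
  qed
  then show "residual {(u, v) \<in> W. (h u, h v) \<in> R} a b n \<in> ?f ` (residuals W \<times> residuals R)"
    by (intro image_eqI[of _ _ "(residual W a b n, residual R (h a) (h b) (n * N))"]) auto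
qed

section \<open>The Myhill-Nerode criterion for regular languages\<close>

lemma regular_languageI:
  fixes Q :: "nat set"
  assumes "finite A" "finite Q" "q0 \<in> Q" "T \<subseteq> Q" "\<And>q a. q \<in> Q \<Longrightarrow> a \<in> A \<Longrightarrow> \<delta> q a \<in> Q"
    and "\<And>w. w \<in> L \<longleftrightarrow> w \<in> lists A \<and> foldl \<delta> q0 w \<in> T"
  shows "regular_language A L"
proof -
  have "L = {w \<in> lists A. foldl \<delta> q0 w \<in> T}" using assms(6) by blast
  with assms(1-5) show ?thesis unfolding regular_language_def by metis
qed

lemma foldl_closed: "q \<in> Q \<Longrightarrow> w \<in> lists A \<Longrightarrow> \<forall>q\<in>Q. \<forall>a\<in>A. \<delta> q a \<in> Q \<Longrightarrow> foldl \<delta> q w \<in> Q"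
  by (induction w arbitrary: q) auto

text \<open>The state reached by a word determines its quotient; conversely the quotients, numbered
  by naturals, serve as states.\<close>

lemma regular_language_iff:
  "regular_language A L \<longleftrightarrow> finite A \<and> L \<subseteq> lists A \<and> finite (left_quotients L)"
proof
  assume "regular_language A L"
  then obtain Q :: "nat set" and q0 \<delta> T where fin: "finite A" "finite Q" and d: "q0 \<in> Q" "\<forall>q\<in>Q. \<forall>a\<in>A. \<delta> q a \<in> Q"
    and L: "L = {w \<in> lists A. foldl \<delta> q0 w \<in> T}"
    unfolding regular_language_def by blast
  \<comment> \<open>A prefix with a letter outside \<open>A\<close> has the empty quotient, which
    need not come from any state.\<close>
  have "left_quotients L \<subseteq> insert {} ((\<lambda>q. {x \<in> lists A. foldl \<delta> q x \<in> T}) ` Q)"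
  proof
    fix D assume "D \<in> left_quotients L"
    then obtain w where D: "D = {x. w @ x \<in> L}" by (auto simp: left_quotients_def)
    show "D \<in> insert {} ((\<lambda>q. {x \<in> lists A. foldl \<delta> q x \<in> T}) ` Q)"
    proof (cases "w \<in> lists A")
      case True
      then have "D = {x \<in> lists A. foldl \<delta> (foldl \<delta> q0 w) x \<in> T}" by (auto simp: D L)
      then show ?thesis using foldl_closed[OF d(1) True d(2)] by blast
    next
      case False
      then have "D = {}" by (auto simp: D L)
      then show ?thesis by blast
    qed
  qed
  then show "finite A \<and> L \<subseteq> lists A \<and> finite (left_quotients L)"
    using fin by (auto simp: L intro: finite_subset)
next
  assume *: "finite A \<and> L \<subseteq> lists A \<and> finite (left_quotients L)"
  then obtain c :: "'a list set \<Rightarrow> nat" where c: "inj_on c (left_quotients L)"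
    using finite_imp_inj_to_nat_seg by metis
  let ?q = "\<lambda>w. {x. w @ x \<in> L}"
  \<comment> \<open>Decode the number to a quotient, strip the letter \<open>a\<close> off its
    words, and number the result again.\<close>
  define \<delta> where "\<delta> q a = c {x. a # x \<in> inv_into (left_quotients L) c q}" for q a
  have q: "?q w \<in> left_quotients L" for w by (auto simp: left_quotients_def)
  have \<delta>: "\<delta> (c (?q w)) a = c (?q (w @ [a]))" for w a
    using c q by (simp add: \<delta>_def inv_into_f_f)
  have f: "foldl \<delta> (c (?q [])) w = c (?q w)" for w
  proof (induction w rule: rev_induct)
    case (snoc a w)
    then show ?case using \<delta>[of w a] by simp
  qed simp
  have acc: "c (?q w) \<in> c ` {D \<in> left_quotients L. [] \<in> D} \<longleftrightarrow> w \<in> L" for w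
  proof -
    have "c (?q w) \<in> c ` {D \<in> left_quotients L. [] \<in> D} \<longleftrightarrow> ?q w \<in> {D \<in> left_quotients L. [] \<in> D}"
      using q by (intro inj_on_image_mem_iff[OF c]) auto
    then show ?thesis using q[of w] by simp
  qed
  show "regular_language A L"
  proof (rule regular_languageI)
    show "w \<in> L \<longleftrightarrow> w \<in> lists A \<and> foldl \<delta> (c (?q [])) w \<in> c ` {D \<in> left_quotients L. [] \<in> D}" for w
      using * unfolding f acc by blast
    show "\<delta> k a \<in> c ` left_quotients L" if k: "k \<in> c ` left_quotients L" for k a
    proof -
      obtain w where "k = c (?q w)" using k by (auto simp: left_quotients_def)
      then show ?thesis using q by (simp only: \<delta>) blast
    qed
    show "c (?q []) \<in> c ` left_quotients L" using q by blast
  qed (use * in auto)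
qed

subsection \<open>Synchronous regularity\<close>

text \<open>What remains of a padded pair after a cut. A padding symbol carries the end vertex of
  its path; if a tape has nothing left, this vertex lies in the part already read and is supplied as
  \<open>s\<close> or \<open>t\<close>.\<close>

definition pad_suffix ::
    "('v, 'e) pre_digraph \<Rightarrow> 'v \<Rightarrow> 'v \<Rightarrow> 'e list \<Rightarrow> 'e list \<Rightarrow> (('e + 'v) \<times> ('e + 'v)) list" where
  "pad_suffix X s t x y = (let m = max (length x) (length y) in
     zip (map Inl x @ replicate (m - length x) (Inr (if x = [] then s else path_target X x)))
         (map Inl y @ replicate (m - length y) (Inr (if y = [] then t else path_target X y))))"

lemma pad_to_split:
  assumes "n \<le> m"
  shows "pad_to X m u = pad_to X n (take n u) @ map Inl (drop n u) @
     replicate (m - n - length (drop n u))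
       (Inr (if drop n u = [] then path_target X (take n u) else path_target X (drop n u)))"
proof (cases "length u \<le> n")
  case True
  then have "m - length u = (n - length u) + (m - n)" using assms by simp
  then show ?thesis using True by (simp add: pad_to_def flip: replicate_add)
next
  case False
  then show ?thesis
    by (simp add: pad_to_def path_target_def last_drop flip: map_append append_assoc)
qed

lemma length_pad_to: "length p \<le> n \<Longrightarrow> length (pad_to X n p) = n"
  by (simp add: pad_to_def)

lemma pad_pair_split:
  assumes "n \<le> max (length u) (length v)"
  shows "pad_pair X (u, v) = zip (pad_to X n (take n u)) (pad_to X n (take n v)) @
     pad_suffix X (path_target X (take n u)) (path_target X (take n v)) (drop n u) (drop n v)"
proof -
  let ?m = "max (length u) (length v)"
  have m: "?m - n = max (length (drop n u)) (length (drop n v))" by auto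
  show ?thesis
    unfolding pad_pair_def pad_suffix_def Let_def prod.case pad_to_split[OF assms] m
    by (rule zip_append) (simp add: length_pad_to)
qed

definition unpad :: "('e + 'v) list \<Rightarrow> 'e list" where
  "unpad z = map projl (filter isl z)"

lemma unpad_pad_to [simp]: "unpad (pad_to X n p) = p"
proof -
  have "unpad (map Inl p) = p" "unpad (replicate k (Inr x)) = []" for k and x :: 'a
    by (induction p) (auto simp: unpad_def)
  then show ?thesis by (simp add: pad_to_def unpad_def)
qed

lemma zip_pad_to_inject:
  assumes "zip (pad_to X n a) (pad_to X n b) = zip (pad_to X n c) (pad_to X n d)"
    and "length a \<le> n" "length b \<le> n" "length c \<le> n" "length d \<le> n"
  shows "a = c \<and> b = d"
proof -
  have "pad_to X n a = pad_to X n c" "pad_to X n b = pad_to X n d"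
    using arg_cong[OF assms(1), of "map fst"] arg_cong[OF assms(1), of "map snd"] assms(2-)
    by (simp_all add: length_pad_to)
  then show ?thesis by (metis unpad_pad_to)
qed

text \<open>The length of the padded word is the common length of the two tapes, and deleting the
  padding then recovers each of them.\<close>

lemma inj_pad_pair:
  fixes X :: "('v, 'e) pre_digraph"
  shows "inj (pad_pair X)"
proof (intro injI, clarify)
  fix a b c d :: "'e list"
  assume eq: "pad_pair X (a, b) = pad_pair X (c, d)"
  have len: "length (pad_pair X (u, v)) = max (length u) (length v)" for u v
    by (simp add: pad_pair_def Let_def length_pad_to)
  then have "max (length a) (length b) = max (length c) (length d)" using eq by metis
  then show "a = c \<and> b = d"
    using eq zip_pad_to_inject[of X "max (length a) (length b)" a b c d]
    by (simp add: pad_pair_def Let_def)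
qed

lemma paths_subset_lists: "wf_digraph X \<Longrightarrow> paths X \<subseteq> lists (arcs X)"
  by (auto simp: paths_iff)

lemma path_target_prefix_in_verts:
  assumes "wf_digraph X" "a @ x \<in> paths X" "a \<noteq> []"
  shows "path_target X a \<in> verts X"
proof -
  have "set a \<subseteq> arcs X" using assms(1,2) by (auto simp: paths_iff)
  then have "last a \<in> arcs X" using assms(3) by auto
  then show ?thesis using assms(1) by (simp add: path_target_def wf_digraph_def)
qed

text \<open>Residuals of \<open>R\<close> and left quotients of the padded language differ only by
  finite information: the vertices at which the prefixes end, and which tapes are over.\<close>

lemma synchronously_regular_iff:
  fixes X :: "('v, 'e) pre_digraph"
  assumes "fin_digraph X"
  shows "synchronously_regular X R \<longleftrightarrow> R \<subseteq> paths X \<times> paths X \<and> finite (residuals R)"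
proof -
  interpret fin_digraph X by fact
  have wf: "wf_digraph X" by unfold_locales
  let ?A = "arcs (graph_prod (pad_graph X) (pad_graph X))"
  let ?L = "pad_pair X ` R"
  define V where "V = insert (path_target X []) (verts X)"
  have finV: "finite V" by (simp add: V_def)
  have V: "path_target X a \<in> V" if "a @ x \<in> paths X" for a x
    using path_target_prefix_in_verts[OF wf that] by (cases "a = []") (auto simp: V_def)
  have finA: "finite ?A" by (simp add: graph_prod_def pad_graph_def)
  have split: "pad_pair X (a @ x, b @ y) = zip (pad_to X n a) (pad_to X n b) @
      pad_suffix X (path_target X a) (path_target X b) x y"
    if "take n (a @ x) = a" "take n (b @ y) = b" "length a = n \<or> length b = n" for a x b y n
    using pad_pair_split[of n "a @ x" "b @ y" X] that residual_drop[OF that(1)] residual_drop[OF that(2)]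
    by (auto simp del: take_append drop_append)
  have 1: "finite (residuals R)" if R: "R \<subseteq> paths X \<times> paths X" and fin: "finite (left_quotients ?L)"
  proof (rule finite_residualsI)
    \<comment> \<open>Here \<open>D\<close> is the quotient by the padded prefix, \<open>s\<close>
      and \<open>t\<close> are the end vertices of the two prefixes, and the flags \<open>f\<close>
      and \<open>g\<close> say which tapes have ended.\<close>
    let ?C = "{{}, {([], [])}} \<union> (\<lambda>(D, s, t, f, g). {(x, y). (f \<longrightarrow> x = []) \<and> (g \<longrightarrow> y = []) \<and> pad_suffix X s t x y \<in> D})
      ` (left_quotients ?L \<times> V \<times> V \<times> (UNIV :: bool set) \<times> (UNIV :: bool set))"
    show "finite ?C" using fin finV by simp
    fix a b n
    show "residual R a b n \<in> ?C"
    proof (cases "residual R a b n = {}")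
      case False
      then obtain x0 y0 where 0: "(a @ x0, b @ y0) \<in> R" "take n (a @ x0) = a" "take n (b @ y0) = b"
        by (auto simp: residual_def)
      have len: "length a \<le> n" "length b \<le> n"
        using 0(2,3) by (metis length_take min.cobounded2)+
      have short: "take n (c @ x) = c \<longleftrightarrow> (length c < n \<longrightarrow> x = [])" if "length c \<le> n" for c x :: "'e list"
        using that by auto
      \<comment> \<open>If both tapes end before \<open>n\<close>, the cut lies beyond the padded
        word and no quotient describes it. A non-empty residual then consists of the pair of empty
        words.\<close>
      consider "length a < n" "length b < n" | "length a = n \<or> length b = n"
        using len by linarith
      then show ?thesis
      proof cases
        case 1
        then have "residual R a b n = {([], [])}" using False by (auto simp: residual_def)
        then show ?thesis by simp
      next
        case 2
        let ?D = "{z. zip (pad_to X n a) (pad_to X n b) @ z \<in> ?L}"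
        have "residual R a b n = {(x, y). (length a < n \<longrightarrow> x = []) \<and> (length b < n \<longrightarrow> y = []) \<and>
            pad_suffix X (path_target X a) (path_target X b) x y \<in> ?D}"
        proof -
          have "(a @ x, b @ y) \<in> R \<longleftrightarrow> pad_suffix X (path_target X a) (path_target X b) x y \<in> ?D"
            if "take n (a @ x) = a" "take n (b @ y) = b" for x y
            using split[OF that 2] inj_image_mem_iff[OF inj_pad_pair] by (metis mem_Collect_eq)
          then show ?thesis unfolding residual_def using short len by blast
        qed
        moreover have "path_target X a \<in> V" "path_target X b \<in> V" using 0(1) R V by blast+
        moreover have "?D \<in> left_quotients ?L" by (simp add: left_quotients_def)
        ultimately have "residual R a b n \<in> (\<lambda>(D, s, t, f, g). {(x, y). (f \<longrightarrow> x = []) \<and> (g \<longrightarrow> y = []) \<and> pad_suffix X s t x y \<in> D})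
          ` (left_quotients ?L \<times> V \<times> V \<times> (UNIV :: bool set) \<times> (UNIV :: bool set))"
          by (intro image_eqI[of _ _ "(?D, path_target X a, path_target X b, length a < n, length b < n)"]) auto
        then show ?thesis by blast
      qed
    qed simp
  qed
  have 2: "?L \<subseteq> lists ?A" if R: "R \<subseteq> paths X \<times> paths X"
  proof
    fix z assume "z \<in> ?L"
    then obtain u v where z: "z = pad_pair X (u, v)" "(u, v) \<in> R" by auto
    then have uv: "u \<in> paths X" "v \<in> paths X" using R by auto
    have "set (pad_to X n p) \<subseteq> arcs (pad_graph X)" if "p \<in> paths X" for n p
      using that path_target_prefix_in_verts[OF wf, of p "[]"]
      by (auto simp: pad_to_def pad_graph_def paths_iff[OF wf])
    from this[OF uv(1)] this[OF uv(2)] show "z \<in> lists ?A"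
      by (fastforce simp: z pad_pair_def Let_def graph_prod_def dest: set_zip_leftD set_zip_rightD)
  qed
  have 3: "finite (left_quotients ?L)" if R: "R \<subseteq> paths X \<times> paths X" and fin: "finite (residuals R)"
  proof (rule finite_subset)
    \<comment> \<open>The empty set stands for words \<open>w\<close> that are not a prefix of any
      padded pair from \<open>R\<close>.\<close>
    let ?C = "insert {} ((\<lambda>(Q, s, t). (\<lambda>(x, y). pad_suffix X s t x y) ` Q) ` (residuals R \<times> V \<times> V))"
    show "finite ?C" using fin finV by simp
    show "left_quotients ?L \<subseteq> ?C"
    proof
      fix D assume "D \<in> left_quotients ?L"
      then obtain w where D: "D = {z. w @ z \<in> ?L}" by (auto simp: left_quotients_def)
      show "D \<in> ?C"
      proof (cases "D = {}")
        case False
        then obtain z u v where uv: "(u, v) \<in> R" "w @ z = pad_pair X (u, v)" by (auto simp: D)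
        let ?n = "length w"
        define a b where "a = take ?n u" and "b = take ?n v"
        have len: "length (pad_pair X (u, v)) = max (length u) (length v)" for u v
          by (simp add: pad_pair_def Let_def length_pad_to)
        have *: "w = zip (pad_to X ?n (take ?n u')) (pad_to X ?n (take ?n v')) \<and>
          z' = pad_suffix X (path_target X (take ?n u')) (path_target X (take ?n v')) (drop ?n u') (drop ?n v')"
          if "w @ z' = pad_pair X (u', v')" for u' v' z'
        proof -
          have "?n \<le> max (length u') (length v')" using arg_cong[OF that, of length] by (simp add: len)
          from pad_pair_split[OF this, of X] that show ?thesis by (simp add: length_pad_to)
        qed
        have w: "w = zip (pad_to X ?n a) (pad_to X ?n b)" using *[OF uv(2)] by (simp add: a_def b_def)
        \<comment> \<open>The padded word is as long as the longer tape, so at least one tape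
          reaches the end of \<open>w\<close>.\<close>
        have lab: "length a = ?n \<or> length b = ?n"
          using arg_cong[OF uv(2), of length] by (auto simp: len a_def b_def max_def split: if_splits)
        have "D = (\<lambda>(x, y). pad_suffix X (path_target X a) (path_target X b) x y) ` residual R a b ?n"
        proof (intro set_eqI iffI)
          fix z' assume "z' \<in> D"
          then obtain u' v' where uv': "(u', v') \<in> R" "w @ z' = pad_pair X (u', v')" by (auto simp: D)
          \<comment> \<open>The word \<open>w\<close> determines both prefixes, so every pair that
            continues \<open>w\<close> is cut into the same \<open>a\<close> and
            \<open>b\<close>.\<close>
          have "take ?n u' = a \<and> take ?n v' = b"
            using *[OF uv'(2)] w by (intro zip_pad_to_inject[of X ?n]) (auto simp: a_def b_def)
          then show "z' \<in> (\<lambda>(x, y). pad_suffix X (path_target X a) (path_target X b) x y) ` residual R a b ?n"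
            using *[OF uv'(2)] uv'(1)
            by (intro image_eqI[of _ _ "(drop ?n u', drop ?n v')"]) (auto simp: residual_def simp del: take_append)
        next
          fix z' assume "z' \<in> (\<lambda>(x, y). pad_suffix X (path_target X a) (path_target X b) x y) ` residual R a b ?n"
          then obtain x y where xy: "(a @ x, b @ y) \<in> R" "take ?n (a @ x) = a" "take ?n (b @ y) = b"
            "z' = pad_suffix X (path_target X a) (path_target X b) x y"
            by (auto simp: residual_def)
          have "w @ z' = pad_pair X (a @ x, b @ y)" using split[OF xy(2,3) lab] w xy(4) by simp
          then show "z' \<in> D" using xy(1) by (simp add: D)
        qed
        moreover have "path_target X a \<in> V" "path_target X b \<in> V"
          using uv(1) R V[of a "drop ?n u"] V[of b "drop ?n v"] by (auto simp: a_def b_def)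
        ultimately show ?thesis
          by (intro insertI2 image_eqI[of _ _ "(residual R a b ?n, path_target X a, path_target X b)"]) auto
      qed simp
    qed
  qed
  show ?thesis unfolding synchronously_regular_def regular_language_iff using 1 2 3 finA by blast
qed

subsection \<open>Representatives of minimal length\<close>

lemma paths_factor:
  assumes "wf_digraph X" "a @ p @ b \<in> paths X" "p \<noteq> []"
  shows "p \<in> paths X"
  using assms by (cases "a = []"; cases "b = []") (auto simp: paths_append_iff)

locale automatic_semigroupoid = semigroupoid S
  for S :: "('v, 'e) pre_semigroupoid" +
  fixes X :: "('v, 'x) pre_digraph" and K :: "'x list set" and \<rho> :: "'x list \<Rightarrow> 'e"
  assumes aut: "automatic_structure S X K \<rho>"
begin

lemma choice: "choice_of_representatives S X K \<rho>"
  using aut by (simp add: automatic_structure_def)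

lemma fin_X: "fin_digraph X"
  using aut by (simp add: automatic_structure_def)

lemma wf_X: "wf_digraph X"
  using choice by (simp add: choice_of_representatives_def)

lemma verts_X: "verts X = objects S"
  using choice by (simp add: choice_of_representatives_def)

lemma K_paths: "K \<subseteq> paths X"
  using choice by (simp add: choice_of_representatives_def)

lemma rho_paths: "\<rho> ` paths X = arrows S"
  using choice by (simp add: choice_of_representatives_def)

lemma rho_K: "\<rho> ` K = arrows S"
  using choice by (simp add: choice_of_representatives_def)

lemma rho_arrow [simp]: "p \<in> paths X \<Longrightarrow> \<rho> p \<in> arrows S"
  using rho_paths by blast

lemma source_rho [simp]: "p \<in> paths X \<Longrightarrow> source S (\<rho> p) = path_source X p"
  and target_rho [simp]: "p \<in> paths X \<Longrightarrow> target S (\<rho> p) = path_target X p"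
  using choice by (auto simp: choice_of_representatives_def semigroupoid_hom_def free_semigroupoid_def)

lemma rho_append:
  "p @ q \<in> paths X \<Longrightarrow> p \<noteq> [] \<Longrightarrow> q \<noteq> [] \<Longrightarrow> \<rho> (p @ q) = mul S (\<rho> p) (\<rho> q)"
  using choice
  by (auto simp: choice_of_representatives_def semigroupoid_hom_def free_semigroupoid_def
      composable_def paths_append_iff[OF wf_X])

lemma rho_cong:
  assumes "a @ p @ b \<in> paths X" "a @ q @ b \<in> paths X" "p \<noteq> []" "q \<noteq> []" "\<rho> p = \<rho> q"
  shows "\<rho> (a @ p @ b) = \<rho> (a @ q @ b)"
proof -
  have "\<rho> (p @ b) = \<rho> (q @ b)"
    using assms paths_factor[OF wf_X, of a "p @ b" "[]"] paths_factor[OF wf_X, of a "q @ b" "[]"]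
    by (cases "b = []") (auto simp: rho_append)
  then show ?thesis using assms by (cases "a = []") (auto simp: rho_append)
qed

definition same_value :: "('x list \<times> 'x list) set" where
  "same_value = {(u, v) \<in> K \<times> K. \<rho> u = \<rho> v}"

text \<open>Ties are kept: an arrow may have several minimal words, all of the same length.\<close>

definition minimal_words :: "'x list set" where
  "minimal_words = {w \<in> K. \<forall>u\<in>K. \<rho> u = \<rho> w \<longrightarrow> length w \<le> length u}"

lemma minimal_words_paths: "w \<in> minimal_words \<Longrightarrow> w \<in> paths X"
  using K_paths by (auto simp: minimal_words_def)

lemma minimal_words_nonempty: "w \<in> minimal_words \<Longrightarrow> w \<noteq> []"
  using minimal_words_paths[of w] by (simp add: paths_def)

lemma rho_minimal_words: "\<rho> ` minimal_words = arrows S"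
proof (intro equalityI subsetI)
  fix x assume "x \<in> \<rho> ` minimal_words"
  then show "x \<in> arrows S" by (auto dest: minimal_words_paths)
next
  fix x assume "x \<in> arrows S"
  then have "x \<in> \<rho> ` K" by (simp add: rho_K)
  then obtain u where "u \<in> K \<and> \<rho> u = x" by blast
  from ex_has_least_nat[of "\<lambda>u. u \<in> K \<and> \<rho> u = x", OF this, of length]
  obtain w where "w \<in> K" "\<rho> w = x" "\<forall>u. u \<in> K \<and> \<rho> u = x \<longrightarrow> length w \<le> length u"
    by (elim exE conjE)
  then have "w \<in> minimal_words" by (auto simp: minimal_words_def)
  then show "x \<in> \<rho> ` minimal_words" using \<open>\<rho> w = x\<close> by blast
qed

lemma finite_residuals_vertex_relation:
  "s \<in> verts X \<Longrightarrow> finite (residuals (vertex_relation X K \<rho> s))"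
  using aut by (simp add: automatic_structure_def synchronously_regular_iff[OF fin_X])

text \<open>The vertex relations split this relation according to the target of the first word, and
  there are finitely many vertices.\<close>

lemma finite_residuals_same_value: "finite (residuals same_value)"
proof -
  have "path_target X u \<in> verts X" if "u \<in> K" for u
    using path_target_prefix_in_verts[OF wf_X, of u "[]"] K_paths that by (auto simp: paths_def)
  then have "same_value = (\<Union>s\<in>verts X. vertex_relation X K \<rho> s)"
    by (auto simp: same_value_def vertex_relation_def)
  then show ?thesis
    using fin_digraph.finite_verts[OF fin_X] finite_residuals_vertex_relation
    by (simp add: finite_residuals_UN)
qed

text \<open>A word of \<open>K\<close> fails to be minimal exactly when it is the second component
  of a pair of words of equal value whose first component is shorter. The range of
  \<open>same_value\<close> is \<open>K\<close> by reflexivity.\<close>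

lemma finite_residuals_minimal_words: "finite (residuals (Id_on minimal_words))"
proof -
  have "Id_on minimal_words =
      Id_on (Range same_value) - Id_on (Range (same_value \<inter> {(u, v). length u < length v}))"
    by (auto simp: same_value_def minimal_words_def Id_on_iff not_less)
  moreover have "finite (residuals (same_value \<inter> {(u, v). length u < length v}))"
    using finite_residuals_same_value finite_residuals_shorter by (rule finite_residuals_Int)
  ultimately show ?thesis
    using finite_residuals_same_value
    by (simp only: finite_residuals_Diff finite_residuals_Id_on_Range)
qed

lemma finite_residuals_restrict:
  assumes "finite (residuals R)"
  shows "finite (residuals (R \<inter> minimal_words \<times> minimal_words))"
proof -
  have "R \<inter> minimal_words \<times> minimal_words = Id_on minimal_words O R O Id_on minimal_words" by auto
  then show ?thesis
    using finite_residuals_relcomp finite_residuals_minimal_words assms by metis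
qed

definition right_mult :: "'e \<Rightarrow> ('x list \<times> 'x list) set" where
  "right_mult z = {(u, v) \<in> minimal_words \<times> minimal_words.
     target S (\<rho> u) = source S z \<and> mul S (\<rho> u) z = \<rho> v}"

text \<open>The arrow \<open>z\<close> is the value of a path, and right multiplication by a path is
  the composition of the right multiplications by its edges. For one edge it is the given edge
  relation, restricted to minimal words.\<close>

lemma finite_residuals_right_mult:
  assumes "z \<in> arrows S"
  shows "finite (residuals (right_mult z))"
proof -
  have edge: "finite (residuals (right_mult (\<rho> [e])))" if "[e] \<in> paths X" for e
  proof -
    have e: "e \<in> arcs X" using that by (simp add: paths_iff[OF wf_X])
    have "(u, v) \<in> right_mult (\<rho> [e]) \<longleftrightarrow> (u, v) \<in> edge_relation X K \<rho> e \<inter> minimal_words \<times> minimal_words"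
      for u v
    proof (cases "u \<in> minimal_words \<and> path_target X u = tail X e")
      case True
      then have u: "u \<in> paths X" "u \<noteq> []" using minimal_words_paths minimal_words_nonempty by auto
      then have "u @ [e] \<in> paths X"
        using True that paths_append_iff[OF wf_X, of u "[e]"] by (simp add: path_source_def)
      then have "\<rho> (u @ [e]) = mul S (\<rho> u) (\<rho> [e])" using u by (simp add: rho_append)
      then show ?thesis
        using True that u by (auto simp: right_mult_def edge_relation_def minimal_words_def path_source_def)
    next
      case False
      then show ?thesis
        using that minimal_words_paths by (auto simp: right_mult_def edge_relation_def path_source_def)
    qed
    then have "right_mult (\<rho> [e]) = edge_relation X K \<rho> e \<inter> minimal_words \<times> minimal_words" by auto
    moreover have "finite (residuals (edge_relation X K \<rho> e))"
      using aut e by (simp add: automatic_structure_def synchronously_regular_iff[OF fin_X])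
    ultimately show ?thesis by (simp add: finite_residuals_restrict)
  qed
  have "finite (residuals (right_mult (\<rho> p)))" if "p \<in> paths X" for p
    using that
  proof (induction p rule: rev_induct)
    case (snoc e p)
    show ?case
    proof (cases "p = []")
      case False
      then have pe: "p \<in> paths X" "[e] \<in> paths X" "path_target X p = path_source X [e]"
        using snoc.prems paths_append_iff[OF wf_X, of p "[e]"] by auto
      have comp: "composable S (\<rho> p) (\<rho> [e])" using pe by (simp add: composable_def)
      have rho: "\<rho> (p @ [e]) = mul S (\<rho> p) (\<rho> [e])" using snoc.prems False by (simp add: rho_append)
      have "right_mult (\<rho> (p @ [e])) = right_mult (\<rho> p) O right_mult (\<rho> [e])"
      proof (intro set_eqI iffI; clarify)
        fix u w assume "(u, w) \<in> right_mult (\<rho> (p @ [e]))"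
        then have uw: "u \<in> minimal_words" "w \<in> minimal_words" "composable S (\<rho> u) (\<rho> p)"
          "mul S (\<rho> u) (mul S (\<rho> p) (\<rho> [e])) = \<rho> w"
          using pe comp minimal_words_paths by (auto simp: right_mult_def rho composable_def source_mul)
        \<comment> \<open>The intermediate product is an arrow, so some minimal word represents it;
          this word links the two relations.\<close>
        then obtain v where "v \<in> minimal_words" "\<rho> v = mul S (\<rho> u) (\<rho> p)"
          using mul_closed rho_minimal_words by (metis imageE)
        then show "(u, w) \<in> right_mult (\<rho> p) O right_mult (\<rho> [e])"
          using uw comp
          by (intro relcompI[of u v]) (auto simp: right_mult_def mul_assoc target_mul composable_def)
      next
        fix u v w assume "(u, v) \<in> right_mult (\<rho> p)" "(v, w) \<in> right_mult (\<rho> [e])"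
        then have *: "u \<in> minimal_words" "w \<in> minimal_words" "target S (\<rho> u) = source S (\<rho> p)"
          "mul S (mul S (\<rho> u) (\<rho> p)) (\<rho> [e]) = \<rho> w" "u \<in> paths X"
          using minimal_words_paths by (auto simp: right_mult_def)
        then have "composable S (\<rho> u) (\<rho> p)" using pe by (simp add: composable_def)
        with * show "(u, w) \<in> right_mult (\<rho> (p @ [e]))"
          using comp by (simp add: right_mult_def rho mul_assoc source_mul)
      qed
      then show ?thesis using snoc.IH[OF pe(1)] edge[OF pe(2)] by (simp add: finite_residuals_relcomp)
    qed (use snoc.prems edge in simp)
  qed (simp add: paths_def)
  then show ?thesis using assms rho_paths by (metis imageE)
qed

text \<open>
  Two prefixes of a factor avoiding \<open>U\<close> that have the same value, and can be completed by the
  same word, would give two minimal words of different lengths for one arrow.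
\<close>

lemma minimal_words_factor_bound:
  assumes fin: "finite (arrows S - U)"
    and ideal: "\<And>x y. x \<in> U \<Longrightarrow> composable S x y \<Longrightarrow> mul S x y \<in> U"
  shows "\<exists>N>0. \<forall>a f b. a @ f @ b \<in> minimal_words \<longrightarrow> length f = N \<longrightarrow> \<rho> f \<in> U"
proof -
  let ?T = "arrows S - U"
  \<comment> \<open>A chosen completion for each residual: prefixes with the same residual are
    completed to minimal words by the same word.\<close>
  define c where "c Q = (SOME x. (x, x) \<in> Q)" for Q :: "('x list \<times> 'x list) set"
  let ?G = "c ` residuals (Id_on minimal_words)"
  \<comment> \<open>One more than the number of pairs of a value outside \<open>U\<close> and a
    completion, so that two prefixes of a factor of this length must share both.\<close>
  let ?N = "Suc (card (?T \<times> ?G))"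
  have "\<rho> f \<in> U" if w: "a @ f @ b \<in> minimal_words" and len: "length f = ?N" for a f b
  proof (rule ccontr)
    assume nU: "\<rho> f \<notin> U"
    have path: "a @ f @ b \<in> paths X" using w by (rule minimal_words_paths)
    have "f \<noteq> []" using len by auto
    then have f: "f \<in> paths X" using paths_factor[OF wf_X path] by blast
    \<comment> \<open>Prefixes are taken from length 1 on, since \<open>\<rho>\<close> has no
      meaning on the empty word. If the value of one lay in \<open>U\<close>, the ideal property
      would put the value of \<open>f\<close> there too.\<close>
    have T: "\<rho> (take k f) \<in> ?T" "take k f \<noteq> []" if "k \<in> {1..?N}" for k
    proof -
      show ne: "take k f \<noteq> []" using that len by auto
      have tp: "take k f \<in> paths X"
        using paths_factor[OF wf_X, of "[]" "take k f" "drop k f"] f ne by simp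
      have "\<rho> (take k f) \<notin> U"
      proof
        assume inU: "\<rho> (take k f) \<in> U"
        show False
        proof (cases "drop k f = []")
          case True
          then show False using inU nU by simp
        next
          case False
          have split: "take k f @ drop k f \<in> paths X" using f by simp
          then have "drop k f \<in> paths X \<and> path_target X (take k f) = path_source X (drop k f)"
            using paths_append_iff[OF wf_X ne False] by blast
          then have "composable S (\<rho> (take k f)) (\<rho> (drop k f))" using tp by (simp add: composable_def)
          from ideal[OF inU this] have "\<rho> (take k f @ drop k f) \<in> U"
            unfolding rho_append[OF split ne False] .
          then show False using nU by simp
        qed
      qed
      then show "\<rho> (take k f) \<in> ?T" using tp by simp
    qed
    define p where "p k = a @ take k f" for k
    define g where "g k = c (residual (Id_on minimal_words) (p k) (p k) (length (p k)))" for k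
    have g: "p k @ g k \<in> minimal_words" for k
    proof -
      let ?Q = "residual (Id_on minimal_words) (p k) (p k) (length (p k))"
      have "a @ f @ b = p k @ drop k f @ b" by (simp add: p_def)
      then have "p k @ drop k f @ b \<in> minimal_words" using w by (simp only:)
      then have "(drop k f @ b, drop k f @ b) \<in> ?Q" by (auto simp: residual_def)
      then have "(g k, g k) \<in> ?Q" unfolding g_def c_def by (rule someI)
      then show ?thesis by (auto simp: residual_def)
    qed
    have sub: "(\<lambda>k. (\<rho> (take k f), g k)) ` {1..?N} \<subseteq> ?T \<times> ?G"
    proof (rule image_subsetI)
      fix k assume "k \<in> {1..?N}"
      then show "(\<rho> (take k f), g k) \<in> ?T \<times> ?G" using T(1)[of k] by (auto simp: g_def)
    qed
    have "finite (?T \<times> ?G)" using fin finite_residuals_minimal_words by simp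
    then have "card ((\<lambda>k. (\<rho> (take k f), g k)) ` {1..?N}) < card {1..?N}"
      using card_mono[OF _ sub] by simp
    then have "\<not> inj_on (\<lambda>k. (\<rho> (take k f), g k)) {1..?N}" by (rule pigeonhole)
    then obtain k l where kl: "k \<in> {1..?N}" "l \<in> {1..?N}" "k \<noteq> l"
      "\<rho> (take k f) = \<rho> (take l f)" "g k = g l"
      unfolding inj_on_def by blast
    \<comment> \<open>The two prefixes agree in value and have the same completion. Minimality of
      both completed words forces equal lengths, although \<open>k\<close> and \<open>l\<close>
      differ.\<close>
    have "\<rho> (a @ take k f @ g k) = \<rho> (a @ take l f @ g k)"
      using g[of k] g[of l] T(2)[OF kl(1)] T(2)[OF kl(2)] kl(4,5)
      by (intro rho_cong minimal_words_paths) (simp_all add: p_def)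
    then have "length (p k @ g k) = length (p l @ g l)"
      using g[of k] g[of l] kl(5) by (intro antisym) (auto simp: minimal_words_def p_def)
    then have "length (take k f) = length (take l f)" using kl(5) by (simp add: p_def)
    then show False using kl(1-3) len by auto
  qed
  then show ?thesis by blast
qed

end

subsection \<open>Cutting words into blocks\<close>

text \<open>
  A letter is a triple of the previous block (or, at the start, the index \<open>i\<close>), the current
  block, and, in the last letter only, the index \<open>l\<close>. Recording two consecutive blocks
  makes the value of a letter depend on the letter alone.
\<close>

function cut_word :: "nat \<Rightarrow> 'i + 'x list \<Rightarrow> 'l \<Rightarrow> 'x list \<Rightarrow> (('i + 'x list) \<times> 'x list \<times> 'l option) list" where
  "cut_word N c l w = (if N = 0 \<or> length w \<le> N then [(c, w, Some l)]
     else (c, take N w, None) # cut_word N (Inr (take N w)) l (drop N w))"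
  by pat_completeness auto
termination by (relation "measure (\<lambda>(N, c, l, w). length w)") auto

declare cut_word.simps [simp del]

lemma cut_short: "length w \<le> N \<Longrightarrow> cut_word N c l w = [(c, w, Some l)]"
  by (simp add: cut_word.simps)

lemma cut_long:
  "0 < N \<Longrightarrow> N < length w \<Longrightarrow>
     cut_word N c l w = (c, take N w, None) # cut_word N (Inr (take N w)) l (drop N w)"
  by (simp add: cut_word.simps[of N c l w])

lemma cut_nonempty [simp]: "cut_word N c l w \<noteq> []"
  by (simp add: cut_word.simps[of N c l w])

lemma concat_cut: "concat (map (fst \<circ> snd) (cut_word N c l w)) = w"
proof (induction N c l w rule: cut_word.induct)
  case (1 N c l w)
  then show ?case by (simp add: cut_word.simps[of N c l w])
qed

text \<open>Every letter except the last carries exactly \<open>N\<close> letters of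
  \<open>w\<close>; once the last letter is included, both sides are all of
  \<open>w\<close>.\<close>

lemma take_concat_cut:
  assumes "0 < N"
  shows "take (n * N) (concat (map (fst \<circ> snd) (cut_word N c l w))) =
    concat (map (fst \<circ> snd) (take n (cut_word N c l w)))"
proof (induction n arbitrary: c w)
  case (Suc n)
  show ?case
  proof (cases "length w \<le> N")
    case False
    then show ?thesis using assms Suc[of "Inr (take N w)" "drop N w"] by (simp add: cut_long)
  qed (simp add: cut_short)
qed simp

definition blocks :: "nat \<Rightarrow> 'x set \<Rightarrow> 'x list set" where
  "blocks N A = {b \<in> lists A. length b \<le> N}"

lemma finite_blocks: "finite A \<Longrightarrow> finite (blocks N A)"
  using finite_lists_length_le[of A N] by (simp add: blocks_def lists_eq_set Collect_conj_eq)

definition letters ::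
    "nat \<Rightarrow> 'x set \<Rightarrow> 'i set \<Rightarrow> 'l set \<Rightarrow> (('i + 'x list) \<times> 'x list \<times> 'l option) set" where
  "letters N A I \<Lambda> = (Inl ` I \<union> Inr ` blocks N A) \<times> blocks N A \<times> insert None (Some ` \<Lambda>)"

lemma finite_letters:
  "finite A \<Longrightarrow> finite I \<Longrightarrow> finite \<Lambda> \<Longrightarrow> finite (letters N A I \<Lambda>)"
  by (simp add: letters_def finite_blocks)

lemma set_cut:
  "0 < N \<Longrightarrow> w \<in> lists A \<Longrightarrow> l \<in> \<Lambda> \<Longrightarrow> c \<in> Inl ` I \<union> Inr ` blocks N A \<Longrightarrow>
     set (cut_word N c l w) \<subseteq> letters N A I \<Lambda>"
proof (induction N c l w rule: cut_word.induct)
  case (1 N c l w)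
  have "take N w \<in> blocks N A" "drop N w \<in> lists A"
    using 1(3) by (auto simp: blocks_def dest: in_set_takeD in_set_dropD)
  moreover have "w \<in> blocks N A" if "length w \<le> N" using that 1(3) by (simp add: blocks_def)
  ultimately show ?case
    using 1 by (cases "length w \<le> N") (auto simp: cut_short cut_long letters_def)
qed

text \<open>An automaton for cut words only has to remember the latest block, which must reappear as
  the context of the next letter. After the letter with the end mark nothing may follow.\<close>

lemma finite_left_quotients_cut:
  assumes "finite A" "0 < N"
  shows "finite (left_quotients (cut_word N c l ` (lists A - {[]})))"
proof (rule finite_subset)
  let ?R = "\<lambda>c. cut_word N c l ` (lists A - {[]})"
  let ?C = "{{}, {[]}} \<union> ?R ` (insert c (Inr ` blocks N A))"
  show "finite ?C" using assms by (simp add: finite_blocks)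
  have "{x. p @ x \<in> ?R c} \<in> {{}, {[]}} \<union> ?R ` (insert c (Inr ` blocks N A))" for p c
  proof (induction p arbitrary: c)
    case (Cons z p)
    obtain c' b o' where z: "z = (c', b, o')" by (cases z)
    show ?case
    proof (cases o')
      case None
      \<comment> \<open>A letter without end mark must carry the expected context and a block of
        exactly \<open>N\<close> letters. The rest \<open>w\<close> is non-empty, so
        \<open>b @ w\<close> is longer than \<open>N\<close> and is indeed cut after
        \<open>b\<close>.\<close>
      have "{x. (z # p) @ x \<in> ?R c} =
        (if c' = c \<and> b \<in> lists A \<and> length b = N then {x. p @ x \<in> ?R (Inr b)} else {})"
      proof (intro set_eqI iffI)
        fix x assume "x \<in> {x. (z # p) @ x \<in> ?R c}"
        then have "z # p @ x \<in> ?R c" by simp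
        then obtain w where "z # p @ x = cut_word N c l w" "w \<in> lists A - {[]}" by (rule imageE)
        then have w: "w \<in> lists A" "cut_word N c l w = z # p @ x" by simp_all
        have long: "N < length w" using w(2) None by (auto simp: z cut_word.simps[of N c l w] split: if_splits)
        have wA: "take N w \<in> lists A" "drop N w \<in> lists A - {[]}"
          using w(1) long by (auto dest: in_set_takeD in_set_dropD)
        have eq: "c' = c" "b = take N w" "p @ x = cut_word N (Inr b) l (drop N w)"
          using w(2) long assms(2) by (auto simp: z cut_long)
        have "p @ x \<in> ?R (Inr b)" unfolding eq(3) using wA(2) by (rule imageI)
        then show "x \<in> (if c' = c \<and> b \<in> lists A \<and> length b = N then {x. p @ x \<in> ?R (Inr b)} else {})"
          using wA(1) long by (simp add: eq(1,2))
      next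
        fix x assume "x \<in> (if c' = c \<and> b \<in> lists A \<and> length b = N then {x. p @ x \<in> ?R (Inr b)} else {})"
        then obtain w where w: "w \<in> lists A - {[]}" "p @ x = cut_word N (Inr b) l w"
          and b: "c' = c" "b \<in> lists A" "length b = N" by (auto split: if_splits)
        then have "cut_word N c l (b @ w) = z # p @ x" using assms(2) None by (simp add: cut_long z)
        moreover have "b @ w \<in> lists A - {[]}" using w(1) b(2) by auto
        ultimately have "z # p @ x \<in> ?R c" by (metis imageI)
        then show "x \<in> {x. (z # p) @ x \<in> ?R c}" by simp
      qed
      moreover have "b \<in> blocks N A" if "b \<in> lists A" "length b = N" using that by (simp add: blocks_def)
      ultimately show ?thesis
        using Cons[of "Inr b"] by (cases "c' = c \<and> b \<in> lists A \<and> length b = N") auto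
    next
      case (Some m)
      have "x = []" if "(z # p) @ x \<in> ?R c" for x
        using that assms(2) Some by (auto simp: z cut_word.simps[of N c l] split: if_splits)
      then have "{x. (z # p) @ x \<in> ?R c} \<subseteq> {[]}" by blast
      then have "{x. (z # p) @ x \<in> ?R c} = {} \<or> {x. (z # p) @ x \<in> ?R c} = {[]}"
        by (rule subset_singletonD)
      then show ?thesis by (elim disjE) (simp_all only: insert_iff Un_iff simp_thms)
    qed
  qed simp
  then show "left_quotients (?R c) \<subseteq> ?C"
    unfolding left_quotients_def by (intro image_subsetI)
qed

text \<open>An injective renaming of letters carries quotients to quotients; prefixes that are not
  renamed prefixes of words in \<open>L\<close> have the empty quotient.\<close>

lemma finite_left_quotients_map:
  assumes L: "finite (left_quotients L)" "L \<subseteq> lists B" and f: "inj_on f B"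
  shows "finite (left_quotients (map f ` L))"
proof (rule finite_subset)
  show "finite (insert {} ((`) (map f) ` left_quotients L))" using L(1) by simp
  show "left_quotients (map f ` L) \<subseteq> insert {} ((`) (map f) ` left_quotients L)"
  proof
    fix D assume "D \<in> left_quotients (map f ` L)"
    then obtain p where D: "D = {x. p @ x \<in> map f ` L}" by (auto simp: left_quotients_def)
    show "D \<in> insert {} ((`) (map f) ` left_quotients L)"
    proof (cases "D = {}")
      case False
      then obtain x v where "p @ x = map f v" "v \<in> L" unfolding D by blast
      then obtain q y where q: "p = map f q" "q @ y \<in> L" by (auto simp: append_eq_map_conv)
      have "D = map f ` {y. q @ y \<in> L}"
      proof (intro set_eqI iffI)
        fix x assume "x \<in> D"
        then obtain v where "map f q @ x = map f v" "v \<in> L" unfolding D q(1) by blast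
        then obtain q' y' where *: "map f q' = map f q" "map f y' = x" "q' @ y' \<in> L"
          by (auto simp: append_eq_map_conv)
        have "q' = q"
        proof -
          have "set q' \<union> set q \<subseteq> B"
            using subsetD[OF L(2) *(3)] subsetD[OF L(2) q(2)] by auto
          then show ?thesis using *(1) f inj_on_map_eq_map[of f q' q] by (metis inj_on_subset)
        qed
        then show "x \<in> map f ` {y. q @ y \<in> L}" using * by blast
      next
        fix x assume "x \<in> map f ` {y. q @ y \<in> L}"
        then obtain y where y: "x = map f y" "q @ y \<in> L" by blast
        then have "p @ x = map f (q @ y)" by (simp add: q(1))
        then show "x \<in> D" unfolding D using y(2) by blast
      qed
      then show ?thesis by (auto simp: left_quotients_def)
    qed simp
  qed
qed

subsection \<open>The Rees matrix semigroup\<close>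

fun product_of :: "('a \<Rightarrow> 'a \<Rightarrow> 'a) \<Rightarrow> 'a list \<Rightarrow> 'a" where
  "product_of m [x] = x"
| "product_of m (x # y # zs) = m x (product_of m (y # zs))"

lemma product_of_Cons: "zs \<noteq> [] \<Longrightarrow> product_of m (x # zs) = m x (product_of m zs)"
  by (cases zs) auto

lemma product_of_closed:
  assumes "\<And>x y. x \<in> M \<Longrightarrow> y \<in> M \<Longrightarrow> m x y \<in> M"
  shows "zs \<noteq> [] \<Longrightarrow> set zs \<subseteq> M \<Longrightarrow> product_of m zs \<in> M"
proof (induction zs)
  case (Cons z zs)
  then show ?case using assms by (cases "zs = []") (auto simp: product_of_Cons)
qed simp

lemma product_of_append:
  assumes closed: "\<And>x y. x \<in> M \<Longrightarrow> y \<in> M \<Longrightarrow> m x y \<in> M"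
    and assoc: "\<And>x y z. x \<in> M \<Longrightarrow> y \<in> M \<Longrightarrow> z \<in> M \<Longrightarrow> m x (m y z) = m (m x y) z"
  shows "ys \<noteq> [] \<Longrightarrow> zs \<noteq> [] \<Longrightarrow> set ys \<subseteq> M \<Longrightarrow> set zs \<subseteq> M \<Longrightarrow>
    product_of m (ys @ zs) = m (product_of m ys) (product_of m zs)"
proof (induction ys)
  case (Cons y ys)
  show ?case
  proof (cases "ys = []")
    case False
    then have "product_of m ys \<in> M" "product_of m zs \<in> M"
      using Cons.prems product_of_closed[OF closed, where zs = ys] product_of_closed[OF closed, where zs = zs] by auto
    then show ?thesis using Cons False assoc by (simp add: product_of_Cons)
  qed (use Cons.prems in \<open>simp add: product_of_Cons\<close>)
qed simp

lemma semigroup_semigroupoid_simps [simp]: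
  "objects (semigroup_semigroupoid A m) = {()}"
  "arrows (semigroup_semigroupoid A m) = A"
  "mul (semigroup_semigroupoid A m) = m"
  by (simp_all add: semigroup_semigroupoid_def)

section \<open>Factorizations around a matrix entry, and finite generation\<close>

context rees_matrix_data
begin

abbreviation "elements \<equiv> rees_carrier S I \<Lambda> F G"
abbreviation "rmul \<equiv> rees_mul S P"

lemma rmul_closed: "x \<in> elements \<Longrightarrow> y \<in> elements \<Longrightarrow> rmul x y \<in> elements"
  using semigroupoid.mul_closed[OF semigroupoid_rees, of x y]
  by (simp add: rees_matrix_semigroup_def composable_def)

lemma rmul_assoc:
  "x \<in> elements \<Longrightarrow> y \<in> elements \<Longrightarrow> z \<in> elements \<Longrightarrow> rmul x (rmul y z) = rmul (rmul x y) z"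
  using semigroupoid.mul_assoc[OF semigroupoid_rees, of x y z]
  by (simp add: rees_matrix_semigroup_def composable_def)

definition is_factorization :: "'e \<Rightarrow> 'e \<times> 'l \<times> 'i \<times> 'e \<Rightarrow> bool" where
  "is_factorization x = (\<lambda>(s, l, i, t). s \<in> arrows S \<and> t \<in> arrows S \<and> l \<in> \<Lambda> \<and> i \<in> I \<and>
     target S s = G l \<and> F i = source S t \<and> x = mul S (mul S s (P l i)) t)"

text \<open>By surjectivity of \<open>F\<close> and \<open>G\<close>, these are exactly the middle
  components of products of two elements of the Rees matrix semigroup.\<close>

definition sandwiched :: "'e set" where
  "sandwiched = {x. \<exists>q. is_factorization x q}"

text \<open>The arrow \<open>y\<close> is absorbed into the right factor \<open>t\<close>.\<close>

lemma sandwiched_ideal: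
  assumes "x \<in> sandwiched" "composable S x y"
  shows "mul S x y \<in> sandwiched"
proof -
  obtain s l i t where q: "s \<in> arrows S" "t \<in> arrows S" "l \<in> \<Lambda>" "i \<in> I" "target S s = G l"
    "F i = source S t" "x = mul S (mul S s (P l i)) t"
    using assms(1) by (auto simp: sandwiched_def is_factorization_def)
  have c: "composable S s (P l i)" "composable S (mul S s (P l i)) t"
    using q P_arrow P_source P_target by (auto simp: composable_def mul_closed target_mul)
  then have ty: "composable S t y" using assms(2) by (simp add: composable_def q(7) target_mul)
  have "is_factorization (mul S x y) (s, l, i, mul S t y)"
    using q ty mul_assoc[OF c(2) ty] by (simp add: is_factorization_def mul_closed source_mul)
  then show ?thesis by (auto simp: sandwiched_def)
qed

lemma finite_of_finitely_generated:
  assumes "finitely_generated (rees_matrix_semigroup S I \<Lambda> F G P)"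
  shows "finite I" "finite \<Lambda>" "finite (arrows S - sandwiched)"
proof -
  obtain A where A: "finite A" "A \<subseteq> elements"
    and gen: "generated (rees_matrix_semigroup S I \<Lambda> F G P) A = elements"
    using assms by (auto simp: finitely_generated_def rees_matrix_semigroup_def)
  \<comment> \<open>A product takes its first index from the left factor and its last index from the
    right factor, and its middle component is sandwiched. So the indices, and the middle components
    that are not sandwiched, come from the generators.\<close>
  have *: "z \<in> elements \<and> fst z \<in> fst ` A \<and> snd (snd z) \<in> (snd \<circ> snd) ` A \<and>
      (fst (snd z) \<in> (fst \<circ> snd) ` A \<or> fst (snd z) \<in> sandwiched)"
    if "z \<in> generated (rees_matrix_semigroup S I \<Lambda> F G P) A" for z
    using that
  proof induction
    case (base a)
    then show ?case using A(2) by auto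
  next
    case (mul e f)
    obtain i x l j y m where ef: "e = (i, x, l)" "f = (j, y, m)" by (metis prod_cases3)
    have "is_factorization (mul S (mul S x (P l j)) y) (x, l, j, y)"
      using mul.IH by (simp add: ef is_factorization_def rees_carrier_def)
    then show ?case
      using mul.IH rmul_closed[of e f]
      by (auto simp: ef rees_matrix_semigroup_def rees_mul_def sandwiched_def)
  qed
  \<comment> \<open>Surjectivity of \<open>F\<close> and \<open>G\<close> makes every arrow a middle
    component.\<close>
  have dec: "\<exists>i\<in>I. \<exists>l\<in>\<Lambda>. (i, x, l) \<in> elements" if "x \<in> arrows S" for x
  proof -
    have "source S x \<in> F ` I" "target S x \<in> G ` \<Lambda>" using that by (simp_all add: F_surj G_surj)
    then show ?thesis using that by (auto simp: rees_carrier_def)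
  qed
  have "I \<subseteq> fst ` A"
  proof
    fix i assume i: "i \<in> I"
    then have "F i \<in> source S ` arrows S" using F_surj by auto
    then obtain x where x: "x \<in> arrows S" "F i = source S x" by auto
    then obtain l where "l \<in> \<Lambda>" "target S x = G l" using dec[of x] by (auto simp: rees_carrier_def)
    then have "(i, x, l) \<in> elements" using x i by (simp add: rees_carrier_def)
    then show "i \<in> fst ` A" using *[of "(i, x, l)"] by (simp add: gen)
  qed
  then show "finite I" using A(1) by (simp add: finite_subset)
  have "\<Lambda> \<subseteq> (snd \<circ> snd) ` A"
  proof
    fix l assume l: "l \<in> \<Lambda>"
    then have "G l \<in> target S ` arrows S" using G_surj by auto
    then obtain x where x: "x \<in> arrows S" "target S x = G l" by auto
    then obtain i where "i \<in> I" "F i = source S x" using dec[of x] by (auto simp: rees_carrier_def)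
    then have "(i, x, l) \<in> elements" using x l by (simp add: rees_carrier_def)
    then show "l \<in> (snd \<circ> snd) ` A" using *[of "(i, x, l)"] by (simp add: gen)
  qed
  then show "finite \<Lambda>" using A(1) by (simp add: finite_subset)
  have "arrows S - sandwiched \<subseteq> (fst \<circ> snd) ` A"
  proof
    fix x assume x: "x \<in> arrows S - sandwiched"
    then obtain i l where "(i, x, l) \<in> elements" using dec[of x] by auto
    then show "x \<in> (fst \<circ> snd) ` A" using *[of "(i, x, l)"] x by (simp add: gen)
  qed
  then show "finite (arrows S - sandwiched)" using A(1) by (simp add: finite_subset)
qed

text \<open>The choice is fixed once per arrow, so that two consecutive letters agree on how the
  block they share is factored.\<close>

definition factorization :: "'e \<Rightarrow> 'e \<times> 'l \<times> 'i \<times> 'e" where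
  "factorization x = (SOME q. is_factorization x q)"

definition left_factor :: "'e \<Rightarrow> 'e" where "left_factor x = fst (factorization x)"
definition row_index :: "'e \<Rightarrow> 'l" where "row_index x = fst (snd (factorization x))"
definition column_index :: "'e \<Rightarrow> 'i" where "column_index x = fst (snd (snd (factorization x)))"
definition right_factor :: "'e \<Rightarrow> 'e" where "right_factor x = snd (snd (snd (factorization x)))"

lemma sandwiched_factorization:
  assumes "x \<in> sandwiched"
  shows "left_factor x \<in> arrows S" "right_factor x \<in> arrows S" "row_index x \<in> \<Lambda>" "column_index x \<in> I"
    "target S (left_factor x) = G (row_index x)" "F (column_index x) = source S (right_factor x)"
    "x = mul S (mul S (left_factor x) (P (row_index x) (column_index x))) (right_factor x)"
    "source S (left_factor x) = source S x" "target S (right_factor x) = target S x"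
proof -
  have "is_factorization x (factorization x)"
    using assms unfolding factorization_def sandwiched_def by (auto intro: someI)
  then have q: "is_factorization x (left_factor x, row_index x, column_index x, right_factor x)"
    by (simp add: left_factor_def row_index_def column_index_def right_factor_def)
  then show q': "left_factor x \<in> arrows S" "right_factor x \<in> arrows S" "row_index x \<in> \<Lambda>" "column_index x \<in> I"
    "target S (left_factor x) = G (row_index x)" "F (column_index x) = source S (right_factor x)"
    and eq: "x = mul S (mul S (left_factor x) (P (row_index x) (column_index x))) (right_factor x)"
    by (simp_all add: is_factorization_def)
  have c: "composable S (left_factor x) (P (row_index x) (column_index x))"
    "composable S (mul S (left_factor x) (P (row_index x) (column_index x))) (right_factor x)"
    using q' P_arrow P_source P_target by (auto simp: composable_def mul_closed target_mul)
  show "source S (left_factor x) = source S x" "target S (right_factor x) = target S x"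
    using c by (subst (2) eq, simp add: source_mul target_mul)+
qed

end

section \<open>The value of a recoded word\<close>

locale automatic_rees_matrix = rees_matrix_data S I \<Lambda> F G P + automatic_semigroupoid S X K \<rho>
  for S :: "('v, 'e) pre_semigroupoid" and I :: "'i set" and \<Lambda> :: "'l set"
    and F :: "'i \<Rightarrow> 'v" and G :: "'l \<Rightarrow> 'v" and P :: "'l \<Rightarrow> 'i \<Rightarrow> 'e"
    and X :: "('v, 'x) pre_digraph" and K :: "'x list set" and \<rho> :: "'x list \<Rightarrow> 'e" +
  fixes N :: nat and enc :: "('i + 'x list) \<times> 'x list \<times> 'l option \<Rightarrow> nat"
  assumes fin_I: "finite I" and fin_\<Lambda>: "finite \<Lambda>" and N_pos: "0 < N"
    and bound: "\<And>a f b. a @ f @ b \<in> minimal_words \<Longrightarrow> length f = N \<Longrightarrow> \<rho> f \<in> sandwiched"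
    and inj_enc: "inj_on enc (letters N (arcs X) I \<Lambda>)"
begin

text \<open>A context is what precedes the current block: \<open>Inl i\<close> at the start of the
  word, \<open>Inr b\<close> after the block \<open>b\<close>. In the second case the factorization
  of \<open>b\<close> leaves a column index and a right factor for the next letter.\<close>

fun first_index :: "'i + 'x list \<Rightarrow> 'i" where
  "first_index (Inl i) = i"
| "first_index (Inr b) = column_index (\<rho> b)"

fun attach :: "'i + 'x list \<Rightarrow> 'e \<Rightarrow> 'e" where
  "attach (Inl i) x = x"
| "attach (Inr b) x = mul S (right_factor (\<rho> b)) x"

text \<open>The condition under which a context may precede an arrow with source
  \<open>v\<close>.\<close>

fun context_at :: "'v \<Rightarrow> 'i + 'x list \<Rightarrow> bool" where
  "context_at v (Inl i) \<longleftrightarrow> i \<in> I \<and> F i = v"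
| "context_at v (Inr b) \<longleftrightarrow> b \<in> paths X \<and> \<rho> b \<in> sandwiched \<and> path_target X b = v"

text \<open>
  With every block factored as \<open>s P t\<close>, a letter takes the factor \<open>t\<close> of the previous block and
  the factor \<open>s\<close> of the current one; the entry \<open>P\<close> is supplied by the multiplication.
\<close>

fun letter_value :: "('i + 'x list) \<times> 'x list \<times> 'l option \<Rightarrow> 'i \<times> 'e \<times> 'l" where
  "letter_value (c, b, None) = (first_index c, attach c (left_factor (\<rho> b)), row_index (\<rho> b))"
| "letter_value (c, b, Some l) = (first_index c, attach c (\<rho> b), l)"

lemma attach:
  assumes "context_at (source S x) c" "x \<in> arrows S"
  shows "first_index c \<in> I" "attach c x \<in> arrows S" "source S (attach c x) = F (first_index c)"
    "target S (attach c x) = target S x"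
proof -
  have "first_index c \<in> I \<and> attach c x \<in> arrows S \<and> source S (attach c x) = F (first_index c) \<and>
    target S (attach c x) = target S x"
  proof (cases c)
    case (Inr b)
    then have "\<rho> b \<in> sandwiched" "composable S (right_factor (\<rho> b)) x"
      using assms sandwiched_factorization(2,9) by (auto simp: composable_def)
    then show ?thesis
      using sandwiched_factorization(4,6)
      by (auto simp: Inr mul_closed source_mul target_mul)
  qed (use assms in auto)
  then show "first_index c \<in> I" "attach c x \<in> arrows S" "source S (attach c x) = F (first_index c)"
    "target S (attach c x) = target S x" by auto
qed

lemma attach_mul:
  assumes "context_at (source S x) c" "composable S x y"
  shows "attach c (mul S x y) = mul S (attach c x) y"
proof (cases c)
  case (Inr b)
  then have "composable S (right_factor (\<rho> b)) x"
    using assms sandwiched_factorization(2,9) by (auto simp: composable_def)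
  then show ?thesis using assms(2) by (simp add: Inr mul_assoc)
qed simp

text \<open>The product telescopes. Between two letters the multiplication inserts the matrix entry
  that completes the factorization of their shared block. The context is arbitrary in the induction
  because the remaining word starts after a block; its factors of length \<open>N\<close> are again
  factors of \<open>w\<close>.\<close>

lemma cut_word_value:
  assumes "w \<in> paths X" "\<And>a f b. w = a @ f @ b \<Longrightarrow> length f = N \<Longrightarrow> \<rho> f \<in> sandwiched"
    and "context_at (path_source X w) c" "l \<in> \<Lambda>" "path_target X w = G l"
  shows "letter_value ` set (cut_word N c l w) \<subseteq> elements \<and>
    product_of rmul (map letter_value (cut_word N c l w)) = (first_index c, attach c (\<rho> w), l)"
  using assms
proof (induction w arbitrary: c rule: length_induct)
  case (1 w)
  note prems = "1.prems"
  show ?case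
  proof (cases "length w \<le> N")
    case True
    then show ?thesis
      using prems attach[of "\<rho> w" c] by (simp add: cut_short rees_carrier_def)
  next
    case False
    define b w' where "b = take N w" and "w' = drop N w"
    have w: "w = b @ w'" "b \<noteq> []" "w' \<noteq> []" "length b = N"
      using False N_pos by (auto simp: b_def w'_def)
    have p: "b \<in> paths X" "w' \<in> paths X" "path_target X b = path_source X w'"
      using prems(1) paths_append_iff[OF wf_X w(2,3)] by (auto simp: w(1))
    have ends: "path_source X w = path_source X b" "path_target X w = path_target X w'"
      using w by (simp_all add: path_source_def path_target_def)
    have \<rho>w: "\<rho> w = mul S (\<rho> b) (\<rho> w')"
      using prems(1) w by (simp add: rho_append)
    have sb: "\<rho> b \<in> sandwiched" using prems(2)[of "[]" b w'] w by simp
    note f = sandwiched_factorization[OF sb]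
    let ?p = "P (row_index (\<rho> b)) (column_index (\<rho> b))"
    have sub: "\<rho> f \<in> sandwiched" if "w' = a @ f @ d" "length f = N" for a f d
      using prems(2)[of "b @ a" f d] that w(1) by simp
    have "length w' < length w" using w N_pos by simp
    then have IH: "letter_value ` set (cut_word N (Inr b) l w') \<subseteq> elements"
      "product_of rmul (map letter_value (cut_word N (Inr b) l w')) =
        (column_index (\<rho> b), mul S (right_factor (\<rho> b)) (\<rho> w'), l)"
      using "1.IH"[rule_format, of w' "Inr b"] p sb prems(4,5) ends sub by simp_all
    have ctx: "context_at (source S (left_factor (\<rho> b))) c"
      using prems(3) p by (simp add: f(8) ends)
    have letter: "(first_index c, attach c (left_factor (\<rho> b)), row_index (\<rho> b)) \<in> elements"
      using attach[OF ctx f(1)] f(3,5) by (simp add: rees_carrier_def)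
    have c1: "composable S (left_factor (\<rho> b)) ?p" using f P_arrow P_source by (simp add: composable_def)
    have c2: "composable S ?p (right_factor (\<rho> b))" using f P_arrow P_target by (simp add: composable_def)
    have c3: "composable S (right_factor (\<rho> b)) (\<rho> w')" using f p by (simp add: composable_def)
    have c4: "composable S (mul S (left_factor (\<rho> b)) ?p) (right_factor (\<rho> b))"
      using c1 c2 by (simp add: composable_def mul_closed target_mul)
    have c5: "composable S (mul S (left_factor (\<rho> b)) ?p) (mul S (right_factor (\<rho> b)) (\<rho> w'))"
      using c4 c3 by (simp add: composable_def mul_closed source_mul)
    \<comment> \<open>Rebracketing: the left factor stays with the first letter, while the right
      factor moves to the remaining word, as its context prescribes.\<close>
    have "\<rho> w = mul S (mul S (left_factor (\<rho> b)) ?p) (mul S (right_factor (\<rho> b)) (\<rho> w'))"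
      unfolding \<rho>w mul_assoc[OF c4 c3] f(7)[symmetric] ..
    moreover have "attach c (mul S (left_factor (\<rho> b)) ?p) = mul S (attach c (left_factor (\<rho> b))) ?p"
      by (rule attach_mul[OF ctx c1])
    moreover have "context_at (source S (mul S (left_factor (\<rho> b)) ?p)) c"
      using ctx c1 by (simp add: source_mul)
    ultimately have "attach c (\<rho> w) =
        mul S (mul S (attach c (left_factor (\<rho> b))) ?p) (mul S (right_factor (\<rho> b)) (\<rho> w'))"
      using attach_mul[OF _ c5] by simp
    then show ?thesis
      using IH letter False N_pos
      by (simp add: cut_long product_of_Cons rees_mul_def flip: b_def w'_def)
  qed
qed

section \<open>The recoded language and its graph\<close>

definition letter_of :: "nat \<Rightarrow> ('i + 'x list) \<times> 'x list \<times> 'l option" where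
  "letter_of = inv_into (letters N (arcs X) I \<Lambda>) enc"

definition word :: "'i \<Rightarrow> 'l \<Rightarrow> 'x list \<Rightarrow> nat list" where
  "word i l w = map enc (cut_word N (Inl i) l w)"

definition decode :: "nat list \<Rightarrow> 'x list" where
  "decode y = concat (map (fst \<circ> snd \<circ> letter_of) y)"

definition word_value :: "nat list \<Rightarrow> 'i \<times> 'e \<times> 'l" where
  "word_value y = product_of rmul (map (letter_value \<circ> letter_of) y)"

definition language :: "nat list set" where
  "language = {word i l w |i l w. i \<in> I \<and> l \<in> \<Lambda> \<and> w \<in> minimal_words \<and>
     path_source X w = F i \<and> path_target X w = G l}"

text \<open>Only letters occurring in \<open>language\<close> become edges: their values lie in
  \<open>elements\<close>, while an arbitrary letter may contain a block that is not sandwiched and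
  so has no factorization.\<close>

definition letter_graph :: "(unit, nat) pre_digraph" where
  "letter_graph = \<lparr>verts = {()}, arcs = \<Union> (set ` language), tail = \<lambda>_. (), head = \<lambda>_. ()\<rparr>"

lemma letter_graph_simps [simp]:
  "verts letter_graph = {()}" "arcs letter_graph = \<Union> (set ` language)" "tail letter_graph x = ()" "head letter_graph x = ()"
  by (simp_all add: letter_graph_def)

lemma letter_of_enc: "z \<in> letters N (arcs X) I \<Lambda> \<Longrightarrow> letter_of (enc z) = z"
  unfolding letter_of_def by (rule inv_into_f_f[OF inj_enc])

lemma set_cut_word:
  "i \<in> I \<Longrightarrow> l \<in> \<Lambda> \<Longrightarrow> w \<in> lists (arcs X) \<Longrightarrow>
     set (cut_word N (Inl i) l w) \<subseteq> letters N (arcs X) I \<Lambda>"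
  using N_pos by (intro set_cut) auto

lemma map_letter_of_word:
  assumes "i \<in> I" "l \<in> \<Lambda>" "w \<in> lists (arcs X)"
  shows "map letter_of (word i l w) = cut_word N (Inl i) l w"
proof -
  have "map (letter_of \<circ> enc) (cut_word N (Inl i) l w) = map id (cut_word N (Inl i) l w)"
    using set_cut_word[OF assms] letter_of_enc by (intro map_cong) auto
  then show ?thesis by (simp add: word_def)
qed

lemma decode_eq: "decode y = concat (map (fst \<circ> snd) (map letter_of y))"
  by (simp add: decode_def comp_assoc)

lemma decode_word:
  "i \<in> I \<Longrightarrow> l \<in> \<Lambda> \<Longrightarrow> w \<in> lists (arcs X) \<Longrightarrow> decode (word i l w) = w"
  unfolding decode_eq by (simp only: map_letter_of_word concat_cut)

lemma take_decode_word:
  "i \<in> I \<Longrightarrow> l \<in> \<Lambda> \<Longrightarrow> w \<in> lists (arcs X) \<Longrightarrow>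
     take (n * N) (decode (word i l w)) = decode (take n (word i l w))"
  by (simp only: decode_eq map_letter_of_word take_concat_cut[OF N_pos] flip: take_map)

lemma minimal_words_lists: "w \<in> minimal_words \<Longrightarrow> w \<in> lists (arcs X)"
  using minimal_words_paths paths_subset_lists[OF wf_X] by blast

lemma finite_left_quotients_word:
  assumes "i \<in> I" "l \<in> \<Lambda>"
  shows "finite (left_quotients (word i l ` (lists (arcs X) - {[]})))"
proof -
  have "word i l ` (lists (arcs X) - {[]}) = map enc ` cut_word N (Inl i) l ` (lists (arcs X) - {[]})"
    unfolding image_image word_def ..
  moreover have "finite (left_quotients (map enc ` cut_word N (Inl i) l ` (lists (arcs X) - {[]})))"
  proof (rule finite_left_quotients_map[OF _ _ inj_enc])
    show "finite (left_quotients (cut_word N (Inl i) l ` (lists (arcs X) - {[]})))"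
      using fin_digraph.finite_arcs[OF fin_X] N_pos by (rule finite_left_quotients_cut)
    show "cut_word N (Inl i) l ` (lists (arcs X) - {[]}) \<subseteq> lists (letters N (arcs X) I \<Lambda>)"
      using set_cut_word[OF assms] by (intro image_subsetI) (simp add: lists_eq_set)
  qed
  ultimately show ?thesis by simp
qed

text \<open>On recoded words, \<open>decode\<close> inverts \<open>word\<close> and cutting after
  \<open>n\<close> letters corresponds to cutting the decoded word after \<open>n * N\<close>. So
  the image of \<open>R\<close> is a preimage under \<open>decode\<close>, taken inside a product of
  two languages with finitely many quotients.\<close>

lemma finite_residuals_word_image:
  assumes "i \<in> I" "l \<in> \<Lambda>" "m \<in> \<Lambda>" "finite (residuals R)" "R \<subseteq> minimal_words \<times> minimal_words"
  shows "finite (residuals (map_prod (word i l) (word i m) ` R))"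
proof -
  let ?A = "lists (arcs X) - {[]}"
  let ?W = "word i l ` ?A \<times> word i m ` ?A"
  have R: "u \<in> ?A" "v \<in> ?A" if "(u, v) \<in> R" for u v
    using assms(5) that minimal_words_lists minimal_words_nonempty by auto
  have "map_prod (word i l) (word i m) ` R = {(p, q) \<in> ?W. (decode p, decode q) \<in> R}"
  proof (intro set_eqI iffI)
    fix z assume "z \<in> map_prod (word i l) (word i m) ` R"
    then obtain u v where z: "z = (word i l u, word i m v)" "(u, v) \<in> R" by auto
    then show "z \<in> {(p, q) \<in> ?W. (decode p, decode q) \<in> R}"
      using R[OF z(2)] assms(1-3) by (simp add: decode_word)
  next
    fix z assume "z \<in> {(p, q) \<in> ?W. (decode p, decode q) \<in> R}"
    then obtain u v where z: "z = (word i l u, word i m v)" "u \<in> ?A" "v \<in> ?A"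
      "(decode (word i l u), decode (word i m v)) \<in> R" by auto
    then have "(u, v) \<in> R" using assms(1-3) by (simp add: decode_word)
    then show "z \<in> map_prod (word i l) (word i m) ` R" unfolding z(1) by force
  qed
  moreover have "finite (residuals {(p, q) \<in> ?W. (decode p, decode q) \<in> R})"
  proof (rule finite_residuals_vimage[OF assms(4)])
    show "finite (residuals ?W)"
      using assms(1-3) by (intro finite_residuals_Times finite_left_quotients_word)
    show "decode (x @ y) = decode x @ decode y" for x y by (simp add: decode_def)
    show "take (n * N) (decode p) = decode (take n p) \<and> take (n * N) (decode q) = decode (take n q)"
      if pq: "(p, q) \<in> ?W" for p q n
    proof -
      obtain u v where "p = word i l u" "q = word i m v" "u \<in> lists (arcs X)" "v \<in> lists (arcs X)"
        using pq by blast
      then show ?thesis using assms(1-3) by (simp only: take_decode_word)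
    qed
  qed
  ultimately show ?thesis by simp
qed

lemma word_value_word:
  assumes "i \<in> I" "l \<in> \<Lambda>" "w \<in> minimal_words" "path_source X w = F i" "path_target X w = G l"
  shows "(letter_value \<circ> letter_of) ` set (word i l w) \<subseteq> elements" "word_value (word i l w) = (i, \<rho> w, l)"
proof -
  have w: "w \<in> paths X" using assms(3) by (rule minimal_words_paths)
  have "letter_value ` set (cut_word N (Inl i) l w) \<subseteq> elements \<and>
      product_of rmul (map letter_value (cut_word N (Inl i) l w)) = (first_index (Inl i), attach (Inl i) (\<rho> w), l)"
    using assms bound by (intro cut_word_value w) auto
  moreover have "map letter_of (word i l w) = cut_word N (Inl i) l w"
    using assms by (intro map_letter_of_word minimal_words_lists)
  ultimately show "(letter_value \<circ> letter_of) ` set (word i l w) \<subseteq> elements" "word_value (word i l w) = (i, \<rho> w, l)"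
    by (auto simp: word_value_def simp flip: set_map map_map image_image)
qed

lemma letter_value_letter_graph: "y \<in> arcs letter_graph \<Longrightarrow> letter_value (letter_of y) \<in> elements"
  using word_value_word(1) by (fastforce simp: language_def)

lemma language_nonempty: "y \<in> language \<Longrightarrow> y \<noteq> []"
  by (auto simp: language_def word_def)

lemma letter_graph_paths: "p \<in> paths letter_graph \<longleftrightarrow> p \<noteq> [] \<and> set p \<subseteq> arcs letter_graph"
proof -
  have "pre_digraph.cas letter_graph () p ()" for p
    by (induction p) (auto simp: pre_digraph.cas.simps)
  then show ?thesis by (simp add: paths_def pre_digraph.awalk_def)
qed

lemma language_paths: "language \<subseteq> paths letter_graph"
  using language_nonempty by (auto simp: letter_graph_paths)

lemma finite_letter_graph: "finite (arcs letter_graph)"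
proof -
  have "arcs letter_graph \<subseteq> enc ` letters N (arcs X) I \<Lambda>"
    using set_cut_word minimal_words_lists by (fastforce simp: language_def word_def)
  then show ?thesis
    using finite_letters[OF fin_digraph.finite_arcs[OF fin_X] fin_I fin_\<Lambda>] finite_subset by blast
qed

lemma fin_digraph_letter_graph: "fin_digraph letter_graph"
  by unfold_locales (use finite_letter_graph in auto)

lemma path_values: "p \<in> paths letter_graph \<Longrightarrow> set (map (letter_value \<circ> letter_of) p) \<subseteq> elements"
proof
  fix z assume p: "p \<in> paths letter_graph" and "z \<in> set (map (letter_value \<circ> letter_of) p)"
  then obtain y where "y \<in> set p" "z = letter_value (letter_of y)" by auto
  moreover have "set p \<subseteq> arcs letter_graph" using p unfolding letter_graph_paths by (rule conjunct2)
  ultimately show "z \<in> elements" using letter_value_letter_graph by blast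
qed

lemma word_value_in_elements: "p \<in> paths letter_graph \<Longrightarrow> word_value p \<in> elements"
  unfolding word_value_def
  by (rule product_of_closed[OF rmul_closed _ path_values]) (auto simp: letter_graph_paths)

lemma word_value_append:
  "p \<in> paths letter_graph \<Longrightarrow> q \<in> paths letter_graph \<Longrightarrow> word_value (p @ q) = rmul (word_value p) (word_value q)"
  unfolding word_value_def map_append
  by (rule product_of_append[OF rmul_closed rmul_assoc _ _ path_values path_values])
    (auto simp: letter_graph_paths)

lemma word_value_language: "word_value ` language = elements"
proof (intro equalityI subsetI)
  fix z assume "z \<in> word_value ` language"
  then show "z \<in> elements" using language_paths word_value_in_elements by auto
next
  fix z assume "z \<in> elements"
  then obtain i x l where z: "z = (i, x, l)" "i \<in> I" "l \<in> \<Lambda>" "x \<in> arrows S" "F i = source S x" "target S x = G l"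
    by (auto simp: rees_carrier_def)
  then have "x \<in> \<rho> ` minimal_words" by (simp add: rho_minimal_words)
  then obtain w where w: "w \<in> minimal_words" "x = \<rho> w" by auto
  then have ends: "path_source X w = F i" "path_target X w = G l"
    using z minimal_words_paths by simp_all
  have "word i l w \<in> language" using z(2,3) w(1) ends by (auto simp: language_def)
  moreover have "word_value (word i l w) = z" using word_value_word(2)[OF z(2,3) w(1) ends] w z by simp
  ultimately show "z \<in> word_value ` language" by blast
qed

section \<open>The automatic structure of the Rees matrix semigroup\<close>

lemma choice_letter_graph:
  "choice_of_representatives (rees_matrix_semigroup S I \<Lambda> F G P) letter_graph language word_value"
proof -
  have "wf_digraph letter_graph" by unfold_locales auto
  moreover have "word_value ` paths letter_graph = elements"
    using word_value_language language_paths word_value_in_elements by blast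
  moreover have "semigroupoid_hom (free_semigroupoid letter_graph) (rees_matrix_semigroup S I \<Lambda> F G P) id word_value"
    using word_value_in_elements word_value_append
    by (auto simp: semigroupoid_hom_def free_semigroupoid_def rees_matrix_semigroup_def composable_def)
  ultimately show ?thesis
    using language_paths word_value_language
    by (simp add: choice_of_representatives_def rees_matrix_semigroup_def)
qed

text \<open>Constrains the first word only; in both uses the second word is forced to the same
  source by its value.\<close>

definition starting_at :: "'v \<Rightarrow> ('x list \<times> 'x list) set" where
  "starting_at v = {w. w \<noteq> [] \<and> tail X (hd w) = v} \<times> UNIV"

lemma finite_residuals_starting_at: "finite (residuals (starting_at v))"
  unfolding starting_at_def
  by (intro finite_residuals_Times finite_left_quotients_hd finite_left_quotients_UNIV)

lemma starting_at_iff: "u \<in> minimal_words \<Longrightarrow> (u, v) \<in> starting_at s \<longleftrightarrow> path_source X u = s"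
  using minimal_words_nonempty by (auto simp: starting_at_def path_source_def)

text \<open>Equal values have equal indices, so both words are recoded with the same
  \<open>i\<close> and \<open>l\<close>, and the middle components give a vertex relation of
  \<open>S\<close>.\<close>

lemma vertex_relation_letter_graph:
  "vertex_relation letter_graph language word_value s = (\<Union>i\<in>I. \<Union>l\<in>\<Lambda>. map_prod (word i l) (word i l) `
     (vertex_relation X K \<rho> (G l) \<inter> minimal_words \<times> minimal_words \<inter> starting_at (F i)))"
    (is "?L = ?R")
proof (intro set_eqI iffI)
  fix z assume "z \<in> ?L"
  then obtain i l u j m v where z: "z = (word i l u, word j m v)"
    and u: "i \<in> I" "l \<in> \<Lambda>" "u \<in> minimal_words" "path_source X u = F i" "path_target X u = G l"
    and v: "j \<in> I" "m \<in> \<Lambda>" "v \<in> minimal_words" "path_source X v = F j" "path_target X v = G m"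
    and eq: "word_value (word i l u) = word_value (word j m v)"
    by (auto simp: vertex_relation_def language_def)
  have *: "j = i" "m = l" "\<rho> u = \<rho> v" using eq by (simp_all add: word_value_word(2)[OF u] word_value_word(2)[OF v])
  have "(u, v) \<in> vertex_relation X K \<rho> (G l) \<inter> minimal_words \<times> minimal_words \<inter> starting_at (F i)"
    using u v * by (simp add: vertex_relation_def starting_at_iff minimal_words_def)
  then show "z \<in> ?R" unfolding z * using u(1,2) by force
next
  fix z assume "z \<in> ?R"
  then obtain i l u v where z: "z = (word i l u, word i l v)" "i \<in> I" "l \<in> \<Lambda>"
    and uv: "(u, v) \<in> vertex_relation X K \<rho> (G l)" "u \<in> minimal_words" "v \<in> minimal_words" "(u, v) \<in> starting_at (F i)"
    by auto
  have u: "path_source X u = F i" "path_target X u = G l" "\<rho> u = \<rho> v"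
    using uv by (simp_all add: starting_at_iff vertex_relation_def)
  then have v: "path_source X v = F i" "path_target X v = G l"
    using source_rho target_rho minimal_words_paths[OF uv(2)] minimal_words_paths[OF uv(3)] by metis+
  show "z \<in> ?L"
    using z uv u v word_value_word(2)[OF z(2,3) uv(2) u(1,2)] word_value_word(2)[OF z(2,3) uv(3) v]
    by (auto simp: vertex_relation_def language_def)
qed

text \<open>Multiplying \<open>(i, \<rho> u, l)\<close> on the right by \<open>(j, x, m)\<close>
  keeps \<open>i\<close>, replaces \<open>l\<close> by \<open>m\<close>, and multiplies the middle
  component by the arrow \<open>mul S (P l j) x\<close>, which depends on \<open>u\<close> only
  through the index \<open>l\<close>.\<close>

lemma edge_relation_letter_graph:
  assumes y: "y \<in> arcs letter_graph" and val: "letter_value (letter_of y) = (j, x, m)"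
  shows "edge_relation letter_graph language word_value y = (\<Union>i\<in>I. \<Union>l\<in>\<Lambda>. map_prod (word i l) (word i m) `
     (right_mult (mul S (P l j) x) \<inter> starting_at (F i)))"
    (is "?L = ?R")
proof -
  have jxm: "j \<in> I" "m \<in> \<Lambda>" "x \<in> arrows S" "F j = source S x" "target S x = G m"
    using letter_value_letter_graph[OF y] by (auto simp: val rees_carrier_def)
  have comp: "composable S (P l j) x" if "l \<in> \<Lambda>" for l
    using that jxm P_arrow P_target by (simp add: composable_def)
  have word_value_y: "word_value (word i l u @ [y]) = (i, mul S (\<rho> u) (mul S (P l j) x), m)"
    if u: "i \<in> I" "l \<in> \<Lambda>" "u \<in> minimal_words" "path_source X u = F i" "path_target X u = G l" for i l u
  proof -
    have "word i l u \<in> language" using u by (auto simp: language_def)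
    then have "word i l u \<in> paths letter_graph" "[y] \<in> paths letter_graph"
      using language_paths y by (blast, simp add: letter_graph_paths)
    moreover have "composable S (\<rho> u) (P l j)"
      using u jxm P_arrow P_source minimal_words_paths by (simp add: composable_def)
    moreover have "word_value [y] = (j, x, m)" by (simp add: word_value_def val)
    ultimately show ?thesis
      using word_value_word(2)[OF u] comp[OF u(2)] by (simp add: word_value_append rees_mul_def mul_assoc)
  qed
  have source_P: "source S (mul S (P l j) x) = G l" if "l \<in> \<Lambda>" for l
    using comp[OF that] that jxm P_source by (simp add: source_mul)
  show ?thesis
  proof (intro set_eqI iffI)
    fix z assume "z \<in> ?L"
    then obtain i l u k n v where z: "z = (word i l u, word k n v)"
      and u: "i \<in> I" "l \<in> \<Lambda>" "u \<in> minimal_words" "path_source X u = F i" "path_target X u = G l"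
      and v: "k \<in> I" "n \<in> \<Lambda>" "v \<in> minimal_words" "path_source X v = F k" "path_target X v = G n"
      and eq: "word_value (word i l u @ [y]) = word_value (word k n v)"
      by (auto simp: edge_relation_def language_def)
    have *: "k = i" "n = m" "mul S (\<rho> u) (mul S (P l j) x) = \<rho> v"
      using eq by (simp_all add: word_value_y[OF u] word_value_word(2)[OF v])
    have "(u, v) \<in> right_mult (mul S (P l j) x) \<inter> starting_at (F i)"
      using u v * minimal_words_paths by (simp add: right_mult_def starting_at_iff source_P)
    then show "z \<in> ?R" unfolding z * using u(1,2) by force
  next
    fix z assume "z \<in> ?R"
    then obtain i l u v where z: "z = (word i l u, word i m v)" "i \<in> I" "l \<in> \<Lambda>"
      and uv: "(u, v) \<in> right_mult (mul S (P l j) x)" "(u, v) \<in> starting_at (F i)"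
      by auto
    have uv': "u \<in> minimal_words" "v \<in> minimal_words" "mul S (\<rho> u) (mul S (P l j) x) = \<rho> v"
      "target S (\<rho> u) = G l"
      using uv(1) source_P[OF z(3)] by (auto simp: right_mult_def)
    have u: "path_source X u = F i" "path_target X u = G l"
      using uv(2) uv' minimal_words_paths by (simp_all add: starting_at_iff)
    \<comment> \<open>The value of \<open>v\<close> is a product, so its source is that of
      \<open>u\<close> and its target that of \<open>x\<close>. This gives the endpoints that
      membership of \<open>word i m v\<close> in \<open>language\<close> demands.\<close>
    have "composable S (\<rho> u) (mul S (P l j) x)"
      using uv' source_P[OF z(3)] comp[OF z(3)] minimal_words_paths by (simp add: composable_def mul_closed)
    then have "source S (\<rho> v) = source S (\<rho> u)" "target S (\<rho> v) = target S x"
      using comp[OF z(3)] by (simp_all add: source_mul target_mul flip: uv'(3))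
    then have v: "path_source X v = F i" "path_target X v = G m"
      using u jxm minimal_words_paths[OF uv'(1)] minimal_words_paths[OF uv'(2)] by simp_all
    show "z \<in> ?L"
      using z jxm uv' u v word_value_y[OF z(2,3) uv'(1) u] word_value_word(2)[OF z(2) jxm(2) uv'(2) v]
      by (auto simp: edge_relation_def language_def)
  qed
qed

lemma automatic_structure_letter_graph:
  "automatic_structure (rees_matrix_semigroup S I \<Lambda> F G P) letter_graph language word_value"
proof -
  have "finite (residuals (edge_relation letter_graph language word_value y))" if y: "y \<in> arcs letter_graph" for y
  proof -
    obtain j x m where val: "letter_value (letter_of y) = (j, x, m)" by (metis prod_cases3)
    then have jxm: "j \<in> I" "m \<in> \<Lambda>" "x \<in> arrows S" "F j = source S x"
      using letter_value_letter_graph[OF y] by (auto simp: rees_carrier_def)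
    have "mul S (P l j) x \<in> arrows S" if "l \<in> \<Lambda>" for l
      using that jxm P_arrow P_target by (simp add: composable_def mul_closed)
    then show ?thesis
      unfolding edge_relation_letter_graph[OF y val] using jxm
      by (intro finite_residuals_UN fin_I fin_\<Lambda> finite_residuals_word_image finite_residuals_Int
          finite_residuals_right_mult finite_residuals_starting_at) (auto simp: right_mult_def)
  qed
  moreover have "finite (residuals (vertex_relation letter_graph language word_value s))" for s
  proof -
    \<comment> \<open>As the target of an arrow, \<open>G l\<close> is a vertex, so its vertex
      relation is among those known to be regular.\<close>
    have "G l \<in> verts X" if "l \<in> \<Lambda>" for l
    proof -
      have "G l \<in> target S ` arrows S" using that G_surj by auto
      then show ?thesis using wf_dgraph by (auto simp: verts_X wf_digraph_def)
    qed
    then show ?thesis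
      unfolding vertex_relation_letter_graph
      by (intro finite_residuals_UN fin_I fin_\<Lambda> finite_residuals_word_image finite_residuals_Int
          finite_residuals_restrict finite_residuals_vertex_relation finite_residuals_starting_at) auto
  qed
  moreover have "edge_relation letter_graph language word_value y \<subseteq> paths letter_graph \<times> paths letter_graph"
    "vertex_relation letter_graph language word_value s \<subseteq> paths letter_graph \<times> paths letter_graph" for y s
    using language_paths by (auto simp: edge_relation_def vertex_relation_def)
  ultimately show ?thesis
    unfolding automatic_structure_def synchronously_regular_iff[OF fin_digraph_letter_graph]
    using choice_letter_graph fin_digraph_letter_graph by blast
qed

end

theorem theorem6p1:
  fixes S :: "('v, 'e) pre_semigroupoid"
    and I :: "'i set" and \<Lambda> :: "'l set"
    and F :: "'i \<Rightarrow> 'v" and G :: "'l \<Rightarrow> 'v" and P :: "'l \<Rightarrow> 'i \<Rightarrow> 'e"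
  assumes "rees_matrix_data S I \<Lambda> F G P"
    and "automatic S"
    and "finitely_generated (rees_matrix_semigroup S I \<Lambda> F G P)"
  shows "automatic (rees_matrix_semigroup S I \<Lambda> F G P)"
proof -
  interpret rees_matrix_data S I \<Lambda> F G P by fact
  obtain X :: "('v, nat) pre_digraph" and K \<rho> where "automatic_structure S X K \<rho>"
    using assms(2) by (auto simp: automatic_def)
  then interpret automatic_semigroupoid S X K \<rho> by unfold_locales
  note fin = finite_of_finitely_generated[OF assms(3)]
  \<comment> \<open>All but finitely many arrows are sandwiched, so the pigeonhole bound provides
    the block length.\<close>
  obtain N where N: "0 < N"
    "\<forall>a f b. a @ f @ b \<in> minimal_words \<longrightarrow> length f = N \<longrightarrow> \<rho> f \<in> sandwiched"
    using minimal_words_factor_bound[OF fin(3) sandwiched_ideal] by blast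
  have "finite (letters N (arcs X) I \<Lambda>)"
    by (intro finite_letters fin fin_digraph.finite_arcs[OF fin_X])
  \<comment> \<open>The letters are numbered because \<open>automatic\<close> asks for edges of type
    \<open>nat\<close>.\<close>
  then obtain enc :: "('i + nat list) \<times> nat list \<times> 'l option \<Rightarrow> nat"
    where "inj_on enc (letters N (arcs X) I \<Lambda>)"
    using finite_imp_inj_to_nat_seg by metis
  then interpret automatic_rees_matrix S I \<Lambda> F G P X K \<rho> N enc
    using fin N by unfold_locales auto
  show ?thesis unfolding automatic_def using automatic_structure_letter_graph by blast
qed

end
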